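(* The exponential growth rate of the number of meanders with shallow top of order $n$, that is, $$\limsup_{n\to\infty}\sqrt[n]{\left|\overline{\mathfrak{M}_1}(n)\right|},$$ is roughly $5.22$.
   Context: For a positive integer $n$, a partition $\pi$ of $\{1,\ldots,n\}$ is non-crossing if there are no two distinct blocks $V,W$ of $\pi$ and numbers $a<b<c<d$ in $\{1,\ldots,n\}$ with $a,c\in V$ and $b,d\in W$. $\mathrm{NC}(n)$ is the set of non-crossing partitions of $\{1,\ldots,n\}$, partially ordered by $\pi\le\rho$ iff every block of $\pi$ is contained in a block of $\rho$. The Hasse diagram $\mathcal{H}_n$ is the undirected graph with vertex set $\mathrm{NC}(n)$ in which $\pi_1,\pi_2$ are joined by an edge iff one of them covers the other; $d_H$ is the graph distance in $\mathcal{H}_n$. $\mathrm{Int}(n)\subseteq\mathrm{NC}(n)$ is the set of interval partitions: those in which every block has the form $\{i\in\mathbb{N}\mid p\le i\le q\}$ for some $p\le q$ in $\{1,\ldots,n\}$. The set of meanders with shallow top of order $n$ is (identified with) $\overline{\mathfrak{M}_1}(n)=\{(\pi,\rho)\in\mathrm{Int}(n)\times\mathrm{NC}(n)\mid d_H(\pi,\rho)=n-1\}$. The exponential growth rate of the number of these meanders is by definition the limit superior of the $n$-th roots of $\left|\overline{\mathfrak{M}_1}(n)\right|$. *)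

theory Defs
  imports
    "HOL-Analysis.Analysis"
    "HOL-Library.Disjoint_Sets"
    "Graph_Theory.Graph_Theory"
begin

definition noncrossing :: "nat set set \<Rightarrow> bool" where
  "noncrossing P \<longleftrightarrow>
     \<not> (\<exists>V\<in>P. \<exists>W\<in>P. V \<noteq> W \<and>
          (\<exists>a b c d. a < b \<and> b < c \<and> c < d \<and> a \<in> V \<and> c \<in> V \<and> b \<in> W \<and> d \<in> W))"

definition NC :: "nat \<Rightarrow> nat set set set" where
  "NC n = {P. partition_on {1..n} P \<and> noncrossing P}"

definition NC_less :: "nat \<Rightarrow> nat set set \<Rightarrow> nat set set \<Rightarrow> bool" where
  "NC_less n P Q \<longleftrightarrow> P \<in> NC n \<and> Q \<in> NC n \<and> refines {1..n} P Q \<and> P \<noteq> Q"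

definition NC_covers :: "nat \<Rightarrow> nat set set \<Rightarrow> nat set set \<Rightarrow> bool" where
  "NC_covers n Q P \<longleftrightarrow> NC_less n P Q \<and> \<not> (\<exists>R. NC_less n P R \<and> NC_less n R Q)"

text \<open>The undirected Hasse diagram is encoded as a symmetric digraph: an undirected edge is
  the pair of its two opposite arcs.\<close>

definition hasse_NC :: "nat \<Rightarrow> nat set set pair_pre_digraph" where
  "hasse_NC n = \<lparr> pverts = NC n,
                  parcs = {(P, Q). NC_covers n P Q \<or> NC_covers n Q P} \<rparr>"

text \<open>Every arc has weight 1, so the cost of a walk is its length.\<close>

definition dist_H :: "nat \<Rightarrow> nat set set \<Rightarrow> nat set set \<Rightarrow> ereal" where
  "dist_H n P Q = wf_digraph.\<mu> (with_proj (hasse_NC n)) (\<lambda>_. 1) P Q"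

text \<open>\<open>\<mu>\<close> is defined inside the locale \<^locale>\<open>wf_digraph\<close>, so its definition only applies
  to graphs satisfying the locale's axioms.\<close>

lemma wf_digraph_hasse_NC: "wf_digraph (with_proj (hasse_NC n))"
  by standard (auto simp: hasse_NC_def NC_covers_def NC_less_def)

lemma symmetric_hasse_NC: "symmetric (with_proj (hasse_NC n))"
  by (auto simp: symmetric_def hasse_NC_def intro!: symI)

definition Int_part :: "nat \<Rightarrow> nat set set set" where
  "Int_part n = {P \<in> NC n. \<forall>V\<in>P. \<exists>p\<in>{1..n}. \<exists>q\<in>{1..n}. p \<le> q \<and> V = {p..q}}"

definition shallow_top_meanders :: "nat \<Rightarrow> (nat set set \<times> nat set set) set" where
  "shallow_top_meanders n =
     {(P, R). P \<in> Int_part n \<and> R \<in> NC n \<and> dist_H n P R = ereal (real n - 1)}"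

lemma finite_NC: "finite (NC n)"
  unfolding NC_def by (rule finite_subset[OF _ finitely_many_partition_on[of "{1..n}"]]) auto

lemma finite_shallow_top_meanders: "finite (shallow_top_meanders n)"
  by (rule finite_subset[of _ "NC n \<times> NC n"])
     (auto simp: shallow_top_meanders_def Int_part_def finite_NC)

text \<open>The limit superior is taken in the extended reals, where it always exists.\<close>

definition shallow_top_growth_rate :: ereal where
  "shallow_top_growth_rate =
     limsup (\<lambda>n. ereal (root n (real (card (shallow_top_meanders n)))))"

end

theory Submission
  imports Defs
begin

text \<open>Write \<open>\<pi>\<close> for the interval partition and \<open>\<rho>\<close> for the other one. Walking through the
  one-block partition, through the partition into singletons, or through the join of \<open>\<pi>\<close> and \<open>\<rho>\<close>
  (which is non-crossing because \<open>\<pi>\<close> is an interval partition) shows that distance \<open>n - 1\<close> forces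
  the bipartite graph of the blocks of \<open>\<pi>\<close> and \<open>\<rho>\<close>, with one edge for each of \<open>1, \<dots>, n\<close>, to be
  a tree. Conversely, replace \<open>\<rho>\<close> by the current point of a walk that starts at \<open>\<pi>\<close>: a merge of
  two blocks lowers the number of components of the graph by at most one, and a split does not
  lower it. Hence a tree does give distance \<open>n - 1\<close>.

  Such a tree is cut at the last element of the \<open>\<rho>\<close>-block of \<open>1\<close> into three smaller ones, of which
  the last two may be empty, and the first one may be empty only together with the second one.
  Hence the generating series \<open>T\<close> satisfies \<open>T = z (1 + T) + z (1 + T)\<^sup>2 T\<close>, and the growth rate is
  the minimum of \<open>(1 + T) (1 + T + T\<^sup>2) / T\<close> over \<open>T > 0\<close>, which is \<open>5.219\<dots>\<close>, attained near \<open>T = 0.565\<close>.\<close>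

section \<open>Distances in the lattice of non-crossing partitions\<close>

text \<open>Two obstacles shape the proof. The join of non-crossing partitions as set partitions may
  have crossings, so the walk through it needs an argument from the convexity of the blocks of
  \<open>\<pi>\<close>. And cutting a tree restricts both partitions to intervals; hence the words
  with relative offsets, for which restriction means taking a factor. Connectedness is tested
  throughout by two-valued functions constant on blocks, which are easy to restrict, glue and shift,
  so no paths between blocks have to be handled.

  The growth rate needs no singularity analysis. Dividing the equation by z T expresses 1/z by the
  quotient that is minimised. If 1/z is above the minimum, some x > 0 dominates the right-hand side
  and thereby all partial sums of T(z); if it is below, a convergent series would have a sum that
  cannot solve the equation. The numerical constants only have to enclose the minimum within the
  tolerance 0.005, which is correct rounding to two decimals.\<close>

lemma noncrossing_iff:
  "noncrossing P \<longleftrightarrow> (\<forall>U\<in>P. \<forall>V\<in>P. \<forall>b\<in>U. \<forall>d\<in>U. \<forall>x\<in>V. \<forall>y\<in>V.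
     b < x \<longrightarrow> x < d \<longrightarrow> y < b \<or> d < y \<longrightarrow> U = V)"
proof
  assume nc: "noncrossing P"
  show "\<forall>U\<in>P. \<forall>V\<in>P. \<forall>b\<in>U. \<forall>d\<in>U. \<forall>x\<in>V. \<forall>y\<in>V.
     b < x \<longrightarrow> x < d \<longrightarrow> y < b \<or> d < y \<longrightarrow> U = V"
  proof (intro ballI impI)
    fix U V b d x y
    assume "U \<in> P" "V \<in> P" "b \<in> U" "d \<in> U" "x \<in> V" "y \<in> V" "b < x" "x < d" "y < b \<or> d < y"
    then show "U = V"
      using nc unfolding noncrossing_def by blast
  qed
next
  assume *: "\<forall>U\<in>P. \<forall>V\<in>P. \<forall>b\<in>U. \<forall>d\<in>U. \<forall>x\<in>V. \<forall>y\<in>V.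
     b < x \<longrightarrow> x < d \<longrightarrow> y < b \<or> d < y \<longrightarrow> U = V"
  show "noncrossing P"
    unfolding noncrossing_def
  proof (rule notI, elim bexE exE conjE)
    fix V W a b c d
    assume "V \<in> P" "W \<in> P" "V \<noteq> W" "a < b" "b < c" "c < d" "a \<in> V" "c \<in> V" "b \<in> W" "d \<in> W"
    then show False
      using *[rule_format, of V W a c b d] by simp
  qed
qed

text \<open>Asking for \<open>x\<close> inside and \<open>y\<close> outside the span of
  \<open>b\<close> and \<open>d\<close> covers both orders in which two blocks can cross, so no
  application has to sort four elements.\<close>

lemma noncrossingD:
  assumes "noncrossing P" "U \<in> P" "V \<in> P" "b \<in> U" "d \<in> U" "x \<in> V" "y \<in> V"
    "b < x" "x < d" "y < b \<or> d < y"
  shows "U = V"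
  by (rule assms(1)[unfolded noncrossing_iff, rule_format, OF assms(2-10)])

lemma partition_on_unique_block:
  "partition_on A P \<Longrightarrow> U \<in> P \<Longrightarrow> V \<in> P \<Longrightarrow> x \<in> U \<Longrightarrow> x \<in> V \<Longrightarrow> U = V"
  by (auto simp: partition_on_def disjoint_def)

lemma partition_on_block_nonempty: "partition_on A P \<Longrightarrow> V \<in> P \<Longrightarrow> \<exists>x. x \<in> V"
  by (metis all_not_in_conv partition_onD3)

lemma partition_on_obtain_block: "partition_on A P \<Longrightarrow> x \<in> A \<Longrightarrow> \<exists>V\<in>P. x \<in> V"
  by (metis Union_iff partition_onD1)

lemma partition_on_block_subset: "partition_on A P \<Longrightarrow> V \<in> P \<Longrightarrow> V \<subseteq> A"
  by (metis Union_upper partition_onD1)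

lemma NC_D:
  assumes "P \<in> NC n"
  shows "partition_on {1..n} P" "noncrossing P" "finite P"
  using assms finite_elements[of "{1..n}" P] by (auto simp: NC_def)

section \<open>Merging two blocks, and the covering relation\<close>

definition merge :: "'a set set \<Rightarrow> 'a set \<Rightarrow> 'a set \<Rightarrow> 'a set set" where
  "merge P V W = insert (V \<union> W) (P - {V, W})"

lemma partition_on_merge:
  assumes "partition_on A P" "V \<in> P" "W \<in> P"
  shows "partition_on A (merge P V W)"
proof (rule partition_onI)
  show "\<Union> (merge P V W) = A"
    using assms by (auto simp: merge_def partition_on_def)
  show "disjnt p q" if "p \<in> merge P V W" "q \<in> merge P V W" "p \<noteq> q" for p q
    using assms that by (auto simp: merge_def partition_on_def disjoint_def disjnt_def)
  show "{} \<notin> merge P V W"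
    using assms by (auto simp: merge_def partition_on_def)
qed

lemma card_merge:
  assumes "partition_on A P" "finite P" "V \<in> P" "W \<in> P" "V \<noteq> W"
  shows "Suc (card (merge P V W)) = card P"
proof -
  have "V \<union> W \<notin> P - {V, W}"
  proof
    assume *: "V \<union> W \<in> P - {V, W}"
    obtain x where "x \<in> V"
      using partition_on_block_nonempty[OF assms(1,3)] by blast
    then have "V \<union> W = V"
      using partition_on_unique_block[OF assms(1), of "V \<union> W" V x] * assms by auto
    then show False
      using * by simp
  qed
  moreover have "card {V, W} \<le> card P"
    using assms by (intro card_mono) auto
  ultimately show ?thesis
    using assms by (simp add: merge_def card_Diff_subset)
qed

lemma refines_merge:
  assumes "partition_on A P" "V \<in> P" "W \<in> P"
  shows "refines A P (merge P V W)"
  using assms partition_on_merge[OF assms] by (auto simp: refines_def merge_def)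

lemma merge_refines:
  assumes "refines A P Q" "V \<in> P" "W \<in> P" "X \<in> Q" "V \<subseteq> X" "W \<subseteq> X"
  shows "refines A (merge P V W) Q"
  using assms partition_on_merge[of A P V W] by (auto simp: refines_def merge_def)

lemma refines_subset:
  assumes "refines A P Q" "V \<in> P" "X \<in> Q" "x \<in> V" "x \<in> X"
  shows "V \<subseteq> X"
proof -
  obtain Y where "Y \<in> Q" "V \<subseteq> Y"
    using assms by (auto simp: refines_def)
  then show ?thesis
    using partition_on_unique_block[of A Q Y X x] assms by (auto simp: refines_def)
qed

text \<open>Merging the blocks of two neighbouring elements \<open>i < j\<close> of a block \<open>X\<close> of the coarser
  partition cannot create a crossing: a block separating \<open>i\<close> from \<open>j\<close> would have an element
  between them, hence lie in a block of the coarser partition that crosses \<open>X\<close>.\<close>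

lemma exists_NC_merge:
  assumes P: "P \<in> NC n" and Q: "Q \<in> NC n" and ref: "refines {1..n} P Q" and ne: "P \<noteq> Q"
  shows "\<exists>V\<in>P. \<exists>W\<in>P. V \<noteq> W \<and> merge P V W \<in> NC n \<and> refines {1..n} (merge P V W) Q"
proof -
  note pP = NC_D(1)[OF P] and pQ = NC_D(1)[OF Q]
  have "\<exists>X\<in>Q. X \<notin> P"
  proof (rule ccontr)
    assume "\<not> (\<exists>X\<in>Q. X \<notin> P)"
    then have "refines {1..n} Q P"
      using pP pQ by (auto simp: refines_def)
    then show False
      using refines_asym[OF ref] ne by simp
  qed
  then obtain X where X: "X \<in> Q" "X \<notin> P" by blast
  let ?split = "\<lambda>i j. i \<in> X \<and> j \<in> X \<and> i < j \<and> (\<exists>V\<in>P. i \<in> V \<and> j \<notin> V)"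
  have same: "\<exists>V\<in>P. x \<in> V" if "x \<in> X" for x
    using partition_on_obtain_block[OF pP] partition_on_block_subset[OF pQ X(1)] that by blast
  have ex: "\<exists>d i. ?split i (i + d)"
  proof -
    obtain x where x: "x \<in> X"
      using partition_on_block_nonempty[OF pQ X(1)] by blast
    then obtain V where V: "V \<in> P" "x \<in> V"
      using same by blast
    have "V \<subset> X"
      using refines_subset[OF ref V(1) X(1) V(2) x] X V by auto
    then obtain y where y: "y \<in> X" "y \<notin> V"
      by (auto dest: psubset_imp_ex_mem)
    then obtain V' where V': "V' \<in> P" "y \<in> V'"
      using same by blast
    have xV': "x \<notin> V'"
      using partition_on_unique_block[OF pP, of V V' x] V V' y by blast
    have "x \<noteq> y" using V y by auto
    then consider "x < y" | "y < x" by linarith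
    then show ?thesis
    proof cases
      case 1
      moreover have "\<exists>V\<in>P. x \<in> V \<and> y \<notin> V"
        using V y by blast
      ultimately show ?thesis
        using x y(1) by (intro exI[of _ "y - x"] exI[of _ x]) simp
    next
      case 2
      moreover have "\<exists>V\<in>P. y \<in> V \<and> x \<notin> V"
        using V' xV' by blast
      ultimately show ?thesis
        using x y(1) by (intro exI[of _ "x - y"] exI[of _ y]) simp
    qed
  qed
  \<comment> \<open>Minimality makes \<open>i\<close> and \<open>j\<close> consecutive in
    \<open>X\<close>: an element of \<open>X\<close> between them would form a closer split pair
    with one of them.\<close>
  define d where "d = (LEAST d. \<exists>i. ?split i (i + d))"
  obtain i where "?split i (i + d)"
    using LeastI_ex[OF ex] unfolding d_def by blast
  then obtain V where V: "V \<in> P" "i \<in> V" "i + d \<notin> V" and ijX: "i \<in> X" "i + d \<in> X" and d: "0 < d"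
    by auto
  define j where "j = i + d"
  obtain W where W: "W \<in> P" "j \<in> W"
    using same ijX by (auto simp: j_def)
  have VW: "V \<noteq> W" and ij: "i < j" and jX: "j \<in> X"
    using V W d ijX by (auto simp: j_def)
  have d_le: "d \<le> l - k" if "?split k l" for k l
    unfolding d_def using that by (intro Least_le exI[of _ k]) auto
  have gap: "l \<notin> X" if "i < l" "l < j" for l
  proof
    assume l: "l \<in> X"
    show False
    proof (cases "l \<in> V")
      case True
      then have "?split l j"
        using V l jX that by (auto simp: j_def)
      then show False
        using d_le[of l j] that by (auto simp: j_def)
    next
      case False
      then have "?split i l"
        using V l ijX that by auto
      then show False
        using d_le[of i l] that by (auto simp: j_def)
    qed
  qed
  have sub: "V \<subseteq> X" "W \<subseteq> X"
    using refines_subset[OF ref] V W X ijX jX by blast+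
  have no_cross: False
    if U: "U \<in> P" "U \<noteq> V" "U \<noteq> W" "b \<in> U" "e \<in> U" "x \<in> V \<union> W" "y \<in> V \<union> W"
      and lt: "b < x" "x < e" "y < b \<or> e < y" for U b e x y
  proof -
    have disj: "k \<notin> U" if "k \<in> V \<union> W" for k
      using partition_on_unique_block[OF pP U(1)] V W U(2,3) that by blast
    have out: "k \<noteq> b \<and> k \<noteq> e" if "k \<in> V \<union> W" for k
      using disj[OF that] U by auto
    \<comment> \<open>Neither \<open>V\<close> nor \<open>W\<close> crosses \<open>U\<close> on its
      own, so each lies wholly inside or wholly outside the span of \<open>b\<close> and
      \<open>e\<close>.\<close>
    have side': "b < l \<and> l < e"
      if "k \<in> Z" "l \<in> Z" "Z = V \<or> Z = W" "b < k" "k < e" for k l Z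
    proof (rule ccontr)
      have Z: "Z \<in> P" "U \<noteq> Z" using that U V W by auto
      assume "\<not> (b < l \<and> l < e)"
      moreover have "l \<noteq> b \<and> l \<noteq> e"
        using out that by blast
      ultimately have "l < b \<or> e < l" by linarith
      then show False
        using noncrossingD[OF NC_D(2)[OF P] U(1) Z(1) U(4,5) that(1,2,4,5)] Z(2) by blast
    qed
    have side: "b < k \<and> k < e \<longleftrightarrow> b < l \<and> l < e" if "k \<in> Z" "l \<in> Z" "Z = V \<or> Z = W" for k l Z
      using side'[OF that] side'[OF that(2,1,3)] by blast
    \<comment> \<open>As \<open>x\<close> is inside and \<open>y\<close> outside, one of
      \<open>V\<close> and \<open>W\<close> is inside and the other outside; hence the span
      separates \<open>i\<close> from \<open>j\<close>.\<close>
    have "b < i \<and> i < e \<longleftrightarrow> \<not> (b < j \<and> j < e)"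
    proof -
      have "x \<in> V \<and> y \<in> W \<or> x \<in> W \<and> y \<in> V"
        using U side[of x V y] side[of x W y] lt by auto
      then show ?thesis
        using side[of x V i] side[of y W j] side[of x W j] side[of y V i] V W lt by auto
    qed
    moreover have "i \<noteq> b" "i \<noteq> e" "j \<noteq> b" "j \<noteq> e"
      using out V W by blast+
    ultimately have cross: "(b < i \<and> i < e \<and> e < j) \<or> (i < b \<and> b < j \<and> j < e)"
      using ij by auto
    \<comment> \<open>One of \<open>b\<close> and \<open>e\<close> lies strictly between the
      neighbours \<open>i\<close> and \<open>j\<close>, so \<open>U\<close> is not part of
      \<open>X\<close>, and the block of \<open>Q\<close> around \<open>U\<close> crosses
      \<open>X\<close>.\<close>
    then have "b \<notin> X \<or> e \<notin> X"
      using gap by blast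
    moreover obtain X' where X': "X' \<in> Q" "U \<subseteq> X'"
      using ref U by (auto simp: refines_def)
    ultimately have "X' \<noteq> X"
      using U by blast
    moreover have bX': "b \<in> X'" and eX': "e \<in> X'"
      using U X' by blast+
    note nX = noncrossingD[OF NC_D(2)[OF Q] X'(1) X(1) bX' eX']
    have "X' = X"
      using cross
    proof (elim disjE conjE)
      assume "b < i" "i < e" "e < j"
      then show ?thesis using nX[OF ijX(1) jX] by blast
    next
      assume "i < b" "b < j" "j < e"
      then show ?thesis using nX[OF jX ijX(1)] by blast
    qed
    ultimately show False by simp
  qed
  have "noncrossing (merge P V W)"
    unfolding noncrossing_iff
  proof (intro ballI impI)
    fix S T b e x y
    assume ST: "S \<in> merge P V W" "T \<in> merge P V W" "b \<in> S" "e \<in> S" "x \<in> T" "y \<in> T"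
      and lt: "b < x" "x < e" "y < b \<or> e < y"
    show "S = T"
    proof (rule ccontr)
      assume "S \<noteq> T"
      moreover have "S = V \<union> W \<or> S \<in> P - {V, W}" "T = V \<union> W \<or> T \<in> P - {V, W}"
        using ST(1,2) by (simp_all only: merge_def insert_iff)
      ultimately consider "S \<in> P - {V, W}" "T \<in> P - {V, W}" | "S \<in> P - {V, W}" "T = V \<union> W"
        | "S = V \<union> W" "T \<in> P - {V, W}"
        by blast
      then show False
      proof cases
        case 1
        then show False
          using noncrossingD[OF NC_D(2)[OF P] _ _ ST(3,4,5,6) lt] \<open>S \<noteq> T\<close> by blast
      next
        case 2
        then show False
          using no_cross[of S b e x y] ST lt by blast
      next
        \<comment> \<open>Here the merged block spans the crossing; reading it from the two elements
          of \<open>T\<close> instead gives the situation already excluded.\<close>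
        case 3
        consider "y < b" | "e < y" using lt by blast
        then show False
        proof cases
          case 1
          then show False
            using no_cross[of T y x b e] 3 ST lt by blast
        next
          case 2
          then show False
            using no_cross[of T x y e b] 3 ST lt by blast
        qed
      qed
    qed
  qed
  then have "merge P V W \<in> NC n"
    using partition_on_merge[OF pP V(1) W(1)] by (simp add: NC_def)
  then show ?thesis
    using merge_refines[OF ref V(1) W(1) X(1) sub] V W VW by blast
qed

lemma refines_card_le:
  assumes "refines A P Q" "finite P"
  shows "card Q \<le> card P"
proof -
  have "\<forall>Y\<in>Q. \<exists>V\<in>P. V \<subseteq> Y"
  proof
    fix Y assume Y: "Y \<in> Q"
    have pP: "partition_on A P" and pQ: "partition_on A Q"
      using assms by (auto simp: refines_def)
    obtain x where x: "x \<in> Y" "x \<in> A"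
      using partition_on_block_nonempty[OF pQ Y] partition_on_block_subset[OF pQ Y] by blast
    then obtain V where "V \<in> P" "x \<in> V"
      using partition_on_obtain_block[OF pP] by blast
    then show "\<exists>V\<in>P. V \<subseteq> Y"
      using refines_subset[OF assms(1)] Y x by blast
  qed
  then obtain g where g: "\<And>Y. Y \<in> Q \<Longrightarrow> g Y \<in> P \<and> g Y \<subseteq> Y"
    by metis
  have "inj_on g Q"
  proof (rule inj_onI)
    fix Y Z assume YZ: "Y \<in> Q" "Z \<in> Q" "g Y = g Z"
    have "g Y \<noteq> {}"
      using g[OF YZ(1)] assms by (auto simp: refines_def partition_on_def)
    then obtain x where "x \<in> Y" "x \<in> Z"
      using g[OF YZ(1)] g[OF YZ(2)] YZ(3) by blast
    then show "Y = Z"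
      using partition_on_unique_block[of A Q Y Z x] YZ assms by (auto simp: refines_def)
  qed
  then show ?thesis
    using g assms(2) by (intro card_inj_on_le[of g]) auto
qed

text \<open>Some merge of two blocks of \<open>P\<close> still refines \<open>Q\<close>; it has one
  block less, and coarsening further adds none.\<close>

lemma NC_less_card:
  assumes "NC_less n P Q"
  shows "card Q < card P"
proof -
  have P: "P \<in> NC n"
    using assms by (simp add: NC_less_def)
  obtain V W where VW: "V \<in> P" "W \<in> P" "V \<noteq> W" "merge P V W \<in> NC n"
    "refines {1..n} (merge P V W) Q"
    using exists_NC_merge[of P n Q] assms by (auto simp: NC_less_def)
  have "card Q \<le> card (merge P V W)"
    using refines_card_le[OF VW(5)] NC_D(3)[OF VW(4)] .
  then show ?thesis
    using card_merge[OF NC_D(1,3)[OF P] VW(1-3)] by simp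
qed

text \<open>A partition strictly between would have its number of blocks strictly between two
  consecutive integers.\<close>

lemma NC_covers_merge:
  assumes P: "P \<in> NC n" and "V \<in> P" "W \<in> P" "V \<noteq> W" and M: "merge P V W \<in> NC n"
  shows "NC_covers n (merge P V W) P"
proof -
  have card: "Suc (card (merge P V W)) = card P"
    using card_merge[OF NC_D(1,3)[OF P]] assms by blast
  then have "NC_less n P (merge P V W)"
    using refines_merge[OF NC_D(1)[OF P]] assms by (auto simp: NC_less_def)
  moreover have False if "NC_less n P R" "NC_less n R (merge P V W)" for R
    using NC_less_card[OF that(1)] NC_less_card[OF that(2)] card by simp
  ultimately show ?thesis
    by (auto simp: NC_covers_def)
qed

text \<open>Some merge lies above \<open>P\<close> and below or at \<open>Q\<close>; a cover leaves
  no room in between, so the merge is \<open>Q\<close>.\<close>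

lemma NC_coversE:
  assumes "NC_covers n Q P"
  obtains V W where "V \<in> P" "W \<in> P" "V \<noteq> W" "Q = merge P V W"
proof -
  have PQ: "P \<in> NC n" "Q \<in> NC n" "refines {1..n} P Q" "P \<noteq> Q"
    using assms by (auto simp: NC_covers_def NC_less_def)
  obtain V W where VW: "V \<in> P" "W \<in> P" "V \<noteq> W" "merge P V W \<in> NC n"
    "refines {1..n} (merge P V W) Q"
    using exists_NC_merge[OF PQ] by blast
  have "NC_less n P (merge P V W)"
    using NC_covers_merge[OF PQ(1) VW(1-4)] by (simp add: NC_covers_def)
  then have "\<not> NC_less n (merge P V W) Q"
    using assms by (auto simp: NC_covers_def)
  then have "Q = merge P V W"
    using VW PQ by (auto simp: NC_less_def)
  then show thesis
    using that VW by blast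
qed

section \<open>Walks and distances in the Hasse diagram\<close>

abbreviation hasse_arcs :: "nat \<Rightarrow> (nat set set \<times> nat set set) set" where
  "hasse_arcs n \<equiv> parcs (hasse_NC n)"

lemma hasse_arcs_iff: "(P, Q) \<in> hasse_arcs n \<longleftrightarrow> NC_covers n P Q \<or> NC_covers n Q P"
  by (simp add: hasse_NC_def)

lemma hasse_arcs_NC: "(P, Q) \<in> hasse_arcs n \<Longrightarrow> P \<in> NC n \<and> Q \<in> NC n"
  by (auto simp: hasse_arcs_iff NC_covers_def NC_less_def)

lemma pverts_hasse_NC: "pverts (hasse_NC n) = NC n"
  by (simp add: hasse_NC_def)

text \<open>Relation powers allow induction on the length from either end. The start has to be a
  vertex since the empty walk demands it, whereas the zeroth power relates any \<open>P\<close> to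
  itself.\<close>

lemma relpow_hasse_arcs_iff_awalk:
  assumes "P \<in> NC n"
  shows "(P, Q) \<in> hasse_arcs n ^^ k \<longleftrightarrow>
    (\<exists>p. pre_digraph.awalk (with_proj (hasse_NC n)) P p Q \<and> length p = k)"
  using assms
proof (induction k arbitrary: P)
  case 0
  interpret wf_digraph "with_proj (hasse_NC n)" by (rule wf_digraph_hasse_NC)
  show ?case
    using 0 by (auto simp: awalk_Nil_iff pverts_hasse_NC)
next
  case (Suc k)
  interpret wf_digraph "with_proj (hasse_NC n)" by (rule wf_digraph_hasse_NC)
  have "(P, Q) \<in> hasse_arcs n ^^ Suc k \<longleftrightarrow>
      (\<exists>S. (P, S) \<in> hasse_arcs n \<and> (S, Q) \<in> hasse_arcs n ^^ k)"
    by (blast dest: relpow_Suc_D2 intro: relpow_Suc_I2)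
  also have "\<dots> \<longleftrightarrow> (\<exists>S p. (P, S) \<in> hasse_arcs n \<and> awalk S p Q \<and> length p = k)"
    using Suc.IH hasse_arcs_NC by blast
  also have "\<dots> \<longleftrightarrow> (\<exists>p. awalk P p Q \<and> length p = Suc k)" (is "?l \<longleftrightarrow> ?r")
  proof
    assume ?l
    then obtain S p where "(P, S) \<in> hasse_arcs n" "awalk S p Q" "length p = k"
      by blast
    then have "awalk P ((P, S) # p) Q \<and> length ((P, S) # p) = Suc k"
      by (simp add: awalk_Cons_iff)
    then show ?r by blast
  next
    assume ?r
    then obtain e p where "awalk P (e # p) Q" "length p = k"
      by (auto simp: length_Suc_conv)
    then show ?l
      by (cases e) (auto simp: awalk_Cons_iff)
  qed
  finally show ?case .
qed

lemma dist_H_le: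
  assumes "P \<in> NC n" "(P, Q) \<in> hasse_arcs n ^^ k"
  shows "dist_H n P Q \<le> ereal (real k)"
proof -
  interpret wf_digraph "with_proj (hasse_NC n)" by (rule wf_digraph_hasse_NC)
  obtain p where "awalk P p Q" "length p = k"
    using assms relpow_hasse_arcs_iff_awalk by blast
  then show ?thesis
    unfolding dist_H_def using min_cost_le_walk_cost[of P p Q "\<lambda>_. 1"]
    by (simp add: awalk_cost_def sum_list_triv)
qed

text \<open>The infimum over an empty set of walks is infinite, so the bound holds in that case
  too.\<close>

lemma dist_H_ge:
  assumes "P \<in> NC n" "\<And>k. (P, Q) \<in> hasse_arcs n ^^ k \<Longrightarrow> m \<le> real k"
  shows "ereal m \<le> dist_H n P Q"
proof -
  interpret wf_digraph "with_proj (hasse_NC n)" by (rule wf_digraph_hasse_NC)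
  show ?thesis
    unfolding dist_H_def \<mu>_def
  proof (rule INF_greatest)
    fix p assume "p \<in> {p. awalk P p Q}"
    then have "m \<le> real (length p)"
      using assms relpow_hasse_arcs_iff_awalk by blast
    then show "ereal m \<le> ereal (awalk_cost (\<lambda>_. 1) p)"
      by (simp add: awalk_cost_def sum_list_triv)
  qed
qed

lemma relpow_hasse_arcs_sym:
  "(P, Q) \<in> hasse_arcs n ^^ k \<Longrightarrow> (Q, P) \<in> hasse_arcs n ^^ k"
proof (induction k arbitrary: Q)
  case (Suc k)
  then obtain S where "(P, S) \<in> hasse_arcs n ^^ k" "(S, Q) \<in> hasse_arcs n"
    by auto
  then show ?case
    using Suc.IH hasse_arcs_iff by (metis relpow_Suc_I2)
qed simp

text \<open>The lattice is graded by the number of blocks: merges that still refine \<open>Q\<close>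
  lead up to \<open>Q\<close>, one arc for each lost block.\<close>

lemma refines_imp_relpow:
  assumes "P \<in> NC n" "Q \<in> NC n" "refines {1..n} P Q"
  shows "(P, Q) \<in> hasse_arcs n ^^ (card P - card Q)"
  using assms
proof (induction "card P - card Q" arbitrary: P)
  case 0
  then have "P = Q"
    using NC_less_card[of n P Q] by (auto simp: NC_less_def)
  then show ?case by simp
next
  case (Suc k)
  then have "P \<noteq> Q" by auto
  then obtain V W where VW: "V \<in> P" "W \<in> P" "V \<noteq> W" "merge P V W \<in> NC n"
    "refines {1..n} (merge P V W) Q"
    using exists_NC_merge[OF Suc.prems] by blast
  have "Suc (card (merge P V W)) = card P"
    using card_merge[OF NC_D(1,3)[OF Suc.prems(1)] VW(1-3)] .
  then have k: "k = card (merge P V W) - card Q" and k': "card P - card Q = Suc k"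
    using Suc.hyps(2) by auto
  have "(merge P V W, Q) \<in> hasse_arcs n ^^ k"
    using Suc.hyps(1)[OF k VW(4) Suc.prems(2) VW(5)] k by simp
  moreover have "(P, merge P V W) \<in> hasse_arcs n"
    using NC_covers_merge[OF Suc.prems(1) VW(1-4)] by (simp add: hasse_arcs_iff)
  ultimately show ?case
    unfolding k' by (rule relpow_Suc_I2[rotated])
qed

lemma dist_H_le_via_coarser:
  assumes "P \<in> NC n" "R \<in> NC n" "T \<in> NC n" "refines {1..n} P T" "refines {1..n} R T"
  shows "dist_H n P R \<le> ereal (real ((card P - card T) + (card R - card T)))"
proof (rule dist_H_le[OF assms(1)])
  show "(P, R) \<in> hasse_arcs n ^^ ((card P - card T) + (card R - card T))"
    unfolding relpow_add
    using refines_imp_relpow[of P n T] relpow_hasse_arcs_sym[OF refines_imp_relpow[of R n T]] assms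
    by blast
qed

lemma dist_H_le_via_finer:
  assumes "P \<in> NC n" "R \<in> NC n" "T \<in> NC n" "refines {1..n} T P" "refines {1..n} T R"
  shows "dist_H n P R \<le> ereal (real ((card T - card P) + (card T - card R)))"
proof (rule dist_H_le[OF assms(1)])
  show "(P, R) \<in> hasse_arcs n ^^ ((card T - card P) + (card T - card R))"
    unfolding relpow_add
    using relpow_hasse_arcs_sym[OF refines_imp_relpow[of T n P]] refines_imp_relpow[of T n R] assms
    by blast
qed

lemma one_block_NC:
  assumes "0 < n"
  shows "{{1..n}} \<in> NC n"
  using assms by (auto simp: NC_def noncrossing_def partition_on_space)

lemma singletons_NC: "(\<lambda>x. {x}) ` {1..n} \<in> NC n"
  by (auto simp: NC_def noncrossing_def partition_on_singletons)

section \<open>Joint connectedness and its relation to the distance\<close>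

definition constant_on_blocks :: "('a \<Rightarrow> 'b) \<Rightarrow> 'a set set \<Rightarrow> bool" where
  "constant_on_blocks f P \<longleftrightarrow> (\<forall>V\<in>P. \<forall>x\<in>V. \<forall>y\<in>V. f x = f y)"

text \<open>Connectedness of the bipartite graph of blocks: it fails exactly if some two-valued
  labelling of the edges is constant around each vertex without being constant.\<close>

definition jointly_connected :: "'a set \<Rightarrow> 'a set set \<Rightarrow> 'a set set \<Rightarrow> bool" where
  "jointly_connected A P R \<longleftrightarrow> (\<forall>f :: 'a \<Rightarrow> bool.
     constant_on_blocks f P \<longrightarrow> constant_on_blocks f R \<longrightarrow> (\<forall>x\<in>A. \<forall>y\<in>A. f x = f y))"

lemma constant_on_blocksD:
  "constant_on_blocks f P \<Longrightarrow> V \<in> P \<Longrightarrow> x \<in> V \<Longrightarrow> y \<in> V \<Longrightarrow> f x = f y"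
  unfolding constant_on_blocks_def by blast

lemma jointly_connectedD:
  assumes "jointly_connected A P R" "constant_on_blocks f P" "constant_on_blocks f R"
    "x \<in> A" "y \<in> A"
  shows "f x = (f y :: bool)"
  using assms unfolding jointly_connected_def by blast

text \<open>The least element serves as the name of a block. It is a colouring with one colour per
  block, and it yields the offsets of the words later on.\<close>

definition block_min :: "nat set set \<Rightarrow> nat \<Rightarrow> nat" where
  "block_min P x = Min (THE V. V \<in> P \<and> x \<in> V)"

lemma block_min_eq:
  assumes "partition_on A P" "V \<in> P" "x \<in> V"
  shows "block_min P x = Min V"
proof -
  have "(THE V. V \<in> P \<and> x \<in> V) = V"
    using assms partition_on_unique_block[OF assms(1)] by (intro the_equality) auto
  then show ?thesis
    by (simp add: block_min_def)
qed

lemma inj_on_Min: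
  assumes "partition_on A P" "finite A"
  shows "inj_on Min P"
proof (rule inj_onI)
  fix V W assume VW: "V \<in> P" "W \<in> P" "Min V = Min W"
  have "finite V" "V \<noteq> {}" "finite W" "W \<noteq> {}"
    using VW assms finite_subset[of _ A] by (auto simp: partition_on_def)
  then have "Min V \<in> V" "Min V \<in> W"
    using VW Min_in by metis+
  then show "V = W"
    using partition_on_unique_block[OF assms(1)] VW by blast
qed

lemma block_min_image:
  assumes "partition_on A P"
  shows "block_min P ` A = Min ` P"
proof
  show "block_min P ` A \<subseteq> Min ` P"
    using assms block_min_eq[OF assms] by (fastforce simp: partition_on_def)
  show "Min ` P \<subseteq> block_min P ` A"
  proof
    fix m assume "m \<in> Min ` P"
    then obtain V where V: "V \<in> P" "m = Min V" by blast
    then obtain x where "x \<in> V"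
      using partition_on_block_nonempty[OF assms] by blast
    moreover have "x \<in> A"
      using partition_on_block_subset[OF assms V(1)] \<open>x \<in> V\<close> by blast
    ultimately show "m \<in> block_min P ` A"
      using block_min_eq[OF assms V(1)] V(2) by (metis image_eqI)
  qed
qed

text \<open>Each step of a walk in the Hasse diagram either splits a block, which preserves the
  colouring, or merges two blocks, which identifies at most two colours.\<close>

lemma walk_colouring:
  assumes "P \<in> NC n" "(P, S) \<in> hasse_arcs n ^^ k"
  shows "\<exists>f :: nat \<Rightarrow> nat. constant_on_blocks f P \<and> constant_on_blocks f S \<and>
    card P + card S \<le> 2 * card (f ` {1..n}) + k"
  using assms(2)
proof (induction k arbitrary: S)
  case 0
  note pP = NC_D(1)[OF assms(1)]
  have "card (block_min P ` {1..n}) = card P"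
    using block_min_image[OF pP] inj_on_Min[OF pP] by (simp add: card_image)
  moreover have "constant_on_blocks (block_min P) P"
    using block_min_eq[OF pP] by (auto simp: constant_on_blocks_def)
  ultimately show ?case
    using 0 by (intro exI[of _ "block_min P"]) auto
next
  case (Suc k)
  then obtain T where T: "(P, T) \<in> hasse_arcs n ^^ k" "(T, S) \<in> hasse_arcs n"
    by auto
  obtain f :: "nat \<Rightarrow> nat" where f: "constant_on_blocks f P" "constant_on_blocks f T"
    "card P + card T \<le> 2 * card (f ` {1..n}) + k"
    using Suc.IH[OF T(1)] by blast
  have TS: "T \<in> NC n" "S \<in> NC n"
    using hasse_arcs_NC[OF T(2)] by auto
  consider "NC_covers n S T" | "NC_covers n T S"
    using T(2) by (auto simp: hasse_arcs_iff)
  then show ?case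
  proof cases
    case 1
    then obtain V W where VW: "V \<in> T" "W \<in> T" "V \<noteq> W" "S = merge T V W"
      by (rule NC_coversE)
    obtain v w where vw: "v \<in> V" "w \<in> W" "v \<in> {1..n}"
      using VW partition_on_block_nonempty[OF NC_D(1)[OF TS(1)]]
        partition_on_block_subset[OF NC_D(1)[OF TS(1)]] by (meson subsetD)
    \<comment> \<open>The colour of \<open>w\<close> is renamed to that of \<open>v\<close>. A lost
      colour costs 2 on the right; the lost block and the additional step pay for it.\<close>
    define g where "g x = (if f x = f w then f v else f x)" for x
    have gv: "f x = f v" if "x \<in> V" for x
      using f(2) VW vw that unfolding constant_on_blocks_def by blast
    have gw: "f x = f w" if "x \<in> W" for x
      using f(2) VW vw that unfolding constant_on_blocks_def by blast
    have "constant_on_blocks g P"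
      using f(1) unfolding constant_on_blocks_def g_def by metis
    moreover have "constant_on_blocks g S"
      unfolding constant_on_blocks_def
    proof (intro ballI)
      fix U x y assume U: "U \<in> S" "x \<in> U" "y \<in> U"
      then consider "U \<in> T" | "U = V \<union> W"
        by (auto simp: VW merge_def)
      then show "g x = g y"
      proof cases
        case 1
        then have "f x = f y"
          using f(2) U unfolding constant_on_blocks_def by blast
        then show ?thesis by (simp add: g_def)
      next
        case 2
        then have "g x = f v" "g y = f v"
          using U gv gw by (auto simp: g_def)
        then show ?thesis by simp
      qed
    qed
    moreover have "f ` {1..n} \<subseteq> insert (f w) (g ` {1..n})"
      by (auto simp: g_def image_iff)
    then have "card (f ` {1..n}) \<le> card (insert (f w) (g ` {1..n}))"
      by (intro card_mono) auto
    then have "card (f ` {1..n}) \<le> Suc (card (g ` {1..n}))"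
      by (metis card_insert_le_m1 card_insert_if finite_imageI finite_atLeastAtMost le_SucI)
    moreover have "Suc (card S) = card T"
      unfolding VW(4) using card_merge[OF NC_D(1,3)[OF TS(1)] VW(1-3)] .
    ultimately show ?thesis
      using f(3) by (intro exI[of _ g]) auto
  next
    case 2
    then obtain V W where VW: "V \<in> S" "W \<in> S" "V \<noteq> W" "T = merge S V W"
      by (rule NC_coversE)
    have "constant_on_blocks f S"
      unfolding constant_on_blocks_def
    proof (intro ballI)
      fix U x y assume U: "U \<in> S" "x \<in> U" "y \<in> U"
      have "\<exists>U'\<in>T. U \<subseteq> U'"
        using U by (auto simp: VW merge_def)
      then show "f x = f y"
        using f(2) U unfolding constant_on_blocks_def by blast
    qed
    moreover have "Suc (card T) = card S"
      unfolding VW(4) using card_merge[OF NC_D(1,3)[OF TS(2)] VW(1-3)] .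
    ultimately show ?thesis
      using f by (intro exI[of _ f]) auto
  qed
qed

lemma Int_part_D:
  assumes "P \<in> Int_part n"
  shows "P \<in> NC n" "V \<in> P \<Longrightarrow> x \<in> V \<Longrightarrow> z \<in> V \<Longrightarrow> x \<le> y \<Longrightarrow> y \<le> z \<Longrightarrow> y \<in> V"
  using assms by (fastforce simp: Int_part_def)+

text \<open>A block of \<open>P\<close> on which \<open>f\<close> is \<open>c\<close> contains
  neither \<open>p\<close> nor \<open>q\<close>; being an interval, it lies on one side of each. So
  the class of \<open>c\<close> can be cut at both places without cutting a block.\<close>

lemma constant_on_blocks_cut:
  assumes "P \<in> Int_part n" "constant_on_blocks f P" "f p \<noteq> c" "f q \<noteq> c"
  shows "constant_on_blocks (\<lambda>l. f l = c \<and> p < l \<and> l < q) P"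
  unfolding constant_on_blocks_def
proof (intro ballI)
  have *: "f l = c \<and> p < l \<and> l < q \<longrightarrow> f m = c \<and> p < m \<and> m < q"
    if V: "V \<in> P" "l \<in> V" "m \<in> V" for V l m
  proof
    assume l: "f l = c \<and> p < l \<and> l < q"
    have const: "f k = c" if "k \<in> V" for k
      using assms(2) V that l unfolding constant_on_blocks_def by metis
    then have "p \<notin> V" "q \<notin> V" using assms by auto
    then have "p < m" "m < q"
      using Int_part_D(2)[OF assms(1) V(1) V(3) V(2), of p] l
        Int_part_D(2)[OF assms(1) V(1) V(2) V(3), of q] by (auto simp: not_less[symmetric])
    then show "f m = c \<and> p < m \<and> m < q"
      using const V by blast
  qed
  show "(f x = c \<and> p < x \<and> x < q) = (f y = c \<and> p < y \<and> y < q)"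
    if "V \<in> P" "x \<in> V" "y \<in> V" for V x y
    using *[OF that] *[OF that(1,3,2)] by blast
qed

text \<open>The blocks of the join are the common components. If two of them crossed, cutting one at
  elements of the other would respect the interval blocks, so a block of \<open>R\<close> would have
  to reach across. Doing this for both components yields two blocks of \<open>R\<close> that
  cross.\<close>

lemma exists_NC_upper_bound:
  assumes P: "P \<in> Int_part n" and R: "R \<in> NC n" and disc: "\<not> jointly_connected {1..n} P R"
  shows "\<exists>T\<in>NC n. refines {1..n} P T \<and> refines {1..n} R T \<and> 2 \<le> card T"
proof -
  let ?A = "{1..n}"
  note pP = NC_D(1)[OF Int_part_D(1)[OF P]] and pR = NC_D(1)[OF R]
  let ?c = "\<lambda>f :: nat \<Rightarrow> bool. constant_on_blocks f P \<and> constant_on_blocks f R"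
  define r where "r = {(x, y). x \<in> ?A \<and> y \<in> ?A \<and> (\<forall>f. ?c f \<longrightarrow> f x = f y)}"
  have equiv: "equiv ?A r"
    by (rule equivI) (auto simp: r_def refl_on_def sym_def trans_def)
  define T where "T = ?A // r"
  have pT: "partition_on ?A T"
    unfolding T_def using partition_on_quotient[OF equiv] .
  have in_T: "(x, y) \<in> r" if "U \<in> T" "x \<in> U" "y \<in> U" for U x y
    using in_quotient_imp_in_rel[OF equiv, of U x y] that by (simp add: T_def)
  have block: "V \<in> T" if "V = r `` {x}" "x \<in> ?A" for V x
    using that by (auto simp: T_def quotientI)
  have ref: "refines ?A Q T" if pQ: "partition_on ?A Q" and cQ: "\<And>f. ?c f \<Longrightarrow> constant_on_blocks f Q" for Q
    unfolding refines_def
  proof (intro conjI ballI pQ pT)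
    fix V assume V: "V \<in> Q"
    then obtain x where x: "x \<in> V"
      using partition_on_block_nonempty[OF pQ] by blast
    have "V \<subseteq> ?A" using partition_on_block_subset[OF pQ V] .
    moreover have "f x = f y" if "?c f" "y \<in> V" for f y
      using cQ[OF that(1)] V x that(2) unfolding constant_on_blocks_def by blast
    ultimately have "V \<subseteq> r `` {x}"
      using x by (auto simp: r_def)
    then show "\<exists>Y\<in>T. V \<subseteq> Y"
      using block[OF refl] x \<open>V \<subseteq> ?A\<close> by blast
  qed
  have nc: "noncrossing T"
    unfolding noncrossing_iff
  proof (intro ballI impI)
    fix U V b d x y
    assume UV: "U \<in> T" "V \<in> T" "b \<in> U" "d \<in> U" "x \<in> V" "y \<in> V"
      and lt: "b < x" "x < d" "y < b \<or> d < y"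
    show "U = V"
    proof (rule ccontr)
      assume "U \<noteq> V"
      then have "(b, x) \<notin> r"
        using UV equiv unfolding T_def by (meson quotient_eq_iff)
      moreover have "b \<in> ?A" "x \<in> ?A"
        using in_T UV by (auto simp: r_def)
      ultimately obtain f where f: "?c f" "f b \<noteq> f x"
        by (auto simp: r_def)
      have fd: "f d = f b" and fy: "f y = f x"
        using in_T[OF UV(1,3,4)] in_T[OF UV(2,5,6)] f by (auto simp: r_def)
      let ?g = "\<lambda>l. f l = f x \<and> b < l \<and> l < d"
      have "constant_on_blocks ?g P"
        using constant_on_blocks_cut[OF P, of f b "f x" d] f fd by auto
      moreover have "?g x \<noteq> ?g y"
        using lt by auto
      ultimately have "\<not> constant_on_blocks ?g R"
        using in_T[OF UV(2,5,6)] by (auto simp: r_def)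
      then obtain B i j where B: "B \<in> R" "i \<in> B" "j \<in> B" "?g i" "\<not> ?g j"
        unfolding constant_on_blocks_def by blast
      have fj: "f j = f x"
        using B f(1) unfolding constant_on_blocks_def by blast
      then have j: "j < b \<or> d < j"
        using B f(2) fd by (metis linorder_neqE_nat)
      \<comment> \<open>The link from \<open>i\<close> to \<open>j\<close> leaves the span of
        \<open>b\<close> and \<open>d\<close>, so its own span contains exactly one of
        \<open>b\<close> and \<open>d\<close>, and the argument repeats with exchanged
        roles.\<close>
      define p q where "p = min i j" and "q = max i j"
      have pq: "f p = f x" "f q = f x" "p \<in> B" "q \<in> B"
        using B fj by (auto simp: p_def q_def min_def max_def)
      let ?h = "\<lambda>l. f l = f b \<and> p < l \<and> l < q"
      have "constant_on_blocks ?h P"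
        using constant_on_blocks_cut[OF P, of f p "f b" q] f pq by auto
      moreover have "?h b \<noteq> ?h d"
        using B(4) j fd by (auto simp: p_def q_def)
      ultimately have "\<not> constant_on_blocks ?h R"
        using in_T[OF UV(1,3,4)] by (auto simp: r_def)
      then obtain C s t where C: "C \<in> R" "s \<in> C" "t \<in> C" "?h s" "\<not> ?h t"
        unfolding constant_on_blocks_def by blast
      have ft: "f t = f b"
        using C f(1) unfolding constant_on_blocks_def by blast
      then have "t < p \<or> q < t"
        using C f(2) pq by (metis linorder_neqE_nat)
      then have "B = C"
        using C(4) by (intro noncrossingD[OF NC_D(2)[OF R] B(1) C(1) pq(3,4) C(2,3)]) auto
      then have "f p = f s"
        using constant_on_blocksD[of f R B p s] f(1) pq C by simp
      then show False
        using C pq f by auto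
    qed
  qed
  obtain f x y where f: "?c f" "x \<in> ?A" "y \<in> ?A" "f x \<noteq> f y"
    using disc unfolding jointly_connected_def by blast
  have xy: "r `` {x} \<in> T" "r `` {y} \<in> T" "x \<in> r `` {x}" "y \<in> r `` {y}"
    using f block by (auto simp: r_def)
  have "(x, y) \<notin> r"
    using f by (auto simp: r_def)
  then have "r `` {x} \<noteq> r `` {y}"
    using xy(4) by auto
  then have "card {r `` {x}, r `` {y}} = 2" by simp
  moreover have "finite T"
    using finite_elements[OF _ pT] by simp
  ultimately have "2 \<le> card T"
    using xy by (metis card_mono empty_subsetI insert_subset)
  then show ?thesis
    using nc pT ref pP pR by (intro bexI[of _ T]) (auto simp: NC_def)
qed

lemma dist_H_eq_iff:
  assumes n: "0 < n" and P: "P \<in> Int_part n" and R: "R \<in> NC n"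
  shows "dist_H n P R = ereal (real n - 1) \<longleftrightarrow>
    jointly_connected {1..n} P R \<and> card P + card R = n + 1"
proof
  note P' = Int_part_D(1)[OF P]
  let ?one = "{{1..n}}" and ?zero = "(\<lambda>x. {x}) ` {1..n}"
  have ref1: "refines {1..n} Q ?one" if "Q \<in> NC n" for Q
    using NC_D(1)[OF that] NC_D(1)[OF one_block_NC[OF n]]
    by (auto simp: refines_def partition_on_def)
  have ref0: "refines {1..n} ?zero Q" if "Q \<in> NC n" for Q
    using NC_D(1)[OF that] partition_on_singletons[of "{1..n}"]
    by (auto simp: refines_def partition_on_def)
  have pos: "card Q \<ge> 1" and le: "card Q \<le> n" if "Q \<in> NC n" for Q
    using refines_card_le[OF ref1[OF that] NC_D(3)[OF that]] refines_card_le[OF ref0[OF that]]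
    by (simp_all add: card_image)
  have up: "dist_H n P R \<le> ereal (real ((card P - 1) + (card R - 1)))"
    using dist_H_le_via_coarser[OF P' R one_block_NC[OF n] ref1[OF P'] ref1[OF R]] by simp
  have down: "dist_H n P R \<le> ereal (real ((n - card P) + (n - card R)))"
    using dist_H_le_via_finer[OF P' R singletons_NC ref0[OF P'] ref0[OF R]]
    by (simp add: card_image)
  {
    assume eq: "dist_H n P R = ereal (real n - 1)"
    \<comment> \<open>Passing through the single block shows that there are at least
      \<open>n + 1\<close> blocks in total, passing through the singletons that there are at most
      \<open>n + 1\<close>.\<close>
    have "real n - 1 \<le> real ((card P - 1) + (card R - 1))"
      and "real n - 1 \<le> real ((n - card P) + (n - card R))"
      using up down by (simp_all add: eq)
    then have sum: "card P + card R = n + 1"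
      using pos[OF P'] pos[OF R] le[OF P'] le[OF R] by linarith
    moreover have "jointly_connected {1..n} P R"
    proof (rule ccontr)
      assume "\<not> jointly_connected {1..n} P R"
      then obtain T where T: "T \<in> NC n" "refines {1..n} P T" "refines {1..n} R T" "2 \<le> card T"
        using exists_NC_upper_bound[OF P R] by blast
      \<comment> \<open>With \<open>n + 1\<close> blocks in total, a common coarsening with two or
        more blocks gives a walk of length at most \<open>n - 3\<close>.\<close>
      have "real n - 1 \<le> real ((card P - card T) + (card R - card T))"
        using dist_H_le_via_coarser[OF P' R T(1-3)] by (simp add: eq)
      moreover have "card T \<le> card P" "card T \<le> card R"
        using refines_card_le T NC_D(3)[OF P'] NC_D(3)[OF R] by blast+
      ultimately show False
        using sum T(4) by linarith
    qed
    ultimately show "jointly_connected {1..n} P R \<and> card P + card R = n + 1" by simp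
  }
  assume *: "jointly_connected {1..n} P R \<and> card P + card R = n + 1"
  have "dist_H n P R \<le> ereal (real n - 1)"
  proof -
    have "real ((card P - 1) + (card R - 1)) = real n - 1"
      using * pos[OF P'] pos[OF R] by linarith
    then show ?thesis using up by simp
  qed
  moreover have "ereal (real n - 1) \<le> dist_H n P R"
  proof (rule dist_H_ge[OF P'])
    fix k assume "(P, R) \<in> hasse_arcs n ^^ k"
    then obtain f :: "nat \<Rightarrow> nat" where f: "constant_on_blocks f P" "constant_on_blocks f R"
      "card P + card R \<le> 2 * card (f ` {1..n}) + k"
      using walk_colouring[OF P'] by blast
    \<comment> \<open>Connectedness leaves one colour, which contributes 2; the other
      \<open>n - 1\<close> must come from \<open>k\<close>.\<close>
    have "constant_on_blocks (\<lambda>x. f x = f 1) P" "constant_on_blocks (\<lambda>x. f x = f 1) R"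
      using f unfolding constant_on_blocks_def by metis+
    then have "f x = f 1" if "x \<in> {1..n}" for x
      using jointly_connectedD[of "{1..n}" P R "\<lambda>x. f x = f 1" x 1] * n that by simp
    then have "f ` {1..n} \<subseteq> {f 1}" by blast
    then have "card (f ` {1..n}) \<le> 1"
      using card_mono[of "{f 1}"] by fastforce
    then show "real n - 1 \<le> real k"
      using f(3) * by linarith
  qed
  ultimately show "dist_H n P R = ereal (real n - 1)"
    by (rule antisym)
qed

section \<open>Words of connected pairs of partitions\<close>

text \<open>A word \<open>w\<close> encodes an interval partition and a non-crossing partition of its set of positions:
  \<open>fst (w ! i)\<close> tells whether \<open>i\<close> begins a block of the former, and \<open>snd (w ! i)\<close> is the distance from
  \<open>i\<close> back to the least element of its block in the latter. These data are relative, so that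
  factors of words encode restrictions of the partitions to intervals.\<close>

definition par :: "(bool \<times> nat) list \<Rightarrow> nat \<Rightarrow> nat" where
  "par w i = i - snd (w ! i)"

text \<open>Offsets stay within the word, so the truncated subtraction in \<open>par\<close> is
  exact and the word can be shifted as a factor.\<close>

definition closed_word :: "(bool \<times> nat) list \<Rightarrow> bool" where
  "closed_word w \<longleftrightarrow> (\<forall>i<length w. snd (w ! i) \<le> i)"

text \<open>The arcs from positions back to the least elements of their blocks must nest. The case
  \<open>i = par w j\<close> makes \<open>par w\<close> idempotent, so that its values really are
  least elements.\<close>

definition nc_word :: "(bool \<times> nat) list \<Rightarrow> bool" where
  "nc_word w \<longleftrightarrow> closed_word w \<and>
     (\<forall>j<length w. \<forall>i\<le>j. par w j \<le> i \<longrightarrow> par w j \<le> par w i)"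

text \<open>These are the functions constant on the blocks of both partitions. At position 0 the
  truncated predecessor is 0 itself, so the first flag imposes nothing.\<close>

definition link_invariant :: "(bool \<times> nat) list \<Rightarrow> (nat \<Rightarrow> 'a) \<Rightarrow> bool" where
  "link_invariant w f \<longleftrightarrow>
     (\<forall>i<length w. (\<not> fst (w ! i) \<longrightarrow> f i = f (i - 1)) \<and> f i = f (par w i))"

definition conn_word :: "(bool \<times> nat) list \<Rightarrow> bool" where
  "conn_word w \<longleftrightarrow> (\<forall>f :: nat \<Rightarrow> bool. link_invariant w f \<longrightarrow> (\<forall>i<length w. f i = f 0))"

definition num_blocks :: "(bool \<times> nat) list \<Rightarrow> nat" where
  "num_blocks w = length (filter fst w) + length (filter (\<lambda>x. snd x = 0) w)"

text \<open>A connected graph with one vertex more than edges is a tree; vertices are blocks, edges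
  are positions. The first flag is prescribed because position 0 always begins an interval
  block.\<close>

definition tree_word :: "(bool \<times> nat) list \<Rightarrow> bool" where
  "tree_word w \<longleftrightarrow> w \<noteq> [] \<and> fst (w ! 0) \<and> nc_word w \<and> conn_word w \<and> num_blocks w = length w + 1"

section \<open>Changing the first flag, and concatenation of words\<close>

text \<open>A factor may start inside an interval block. Changing its first flag makes it a word in
  its own right, and changing it back restores the factor.\<close>

definition set_head :: "bool \<Rightarrow> (bool \<times> nat) list \<Rightarrow> (bool \<times> nat) list" where
  "set_head b w = (case w of [] \<Rightarrow> [] | x # xs \<Rightarrow> (b, snd x) # xs)"

lemma length_set_head [simp]: "length (set_head b w) = length w"
  by (auto simp: set_head_def split: list.splits)

lemma set_head_eq_Nil [simp]: "set_head b w = [] \<longleftrightarrow> w = []"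
  by (auto simp: set_head_def split: list.splits)

lemma set_head_set_head [simp]: "set_head a (set_head b w) = set_head a w"
  by (auto simp: set_head_def split: list.splits)

lemma set_head_id: "(w \<noteq> [] \<Longrightarrow> fst (w ! 0) = b) \<Longrightarrow> set_head b w = w"
  by (cases w) (auto simp: set_head_def)

lemma fst_set_head: "w \<noteq> [] \<Longrightarrow> fst (set_head b w ! 0) = b"
  by (auto simp: set_head_def split: list.splits)

lemma snd_set_head [simp]: "i < length w \<Longrightarrow> snd (set_head b w ! i) = snd (w ! i)"
  by (cases i) (auto simp: set_head_def split: list.splits)

lemma par_set_head [simp]: "i < length w \<Longrightarrow> par (set_head b w) i = par w i"
  by (simp add: par_def)

lemma closed_word_set_head [simp]: "closed_word (set_head b w) = closed_word w"
  by (simp add: closed_word_def)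

lemma nc_word_set_head [simp]: "nc_word (set_head b w) = nc_word w"
  by (auto simp: nc_word_def)

lemma link_invariant_set_head [simp]: "link_invariant (set_head b w) f = link_invariant w f"
proof -
  have "(\<not> fst (set_head b w ! i) \<longrightarrow> f i = f (i - 1)) = (\<not> fst (w ! i) \<longrightarrow> f i = f (i - 1))"
    if "i < length w" for i
    using that by (cases i) (auto simp: set_head_def split: list.splits)
  then show ?thesis
    by (auto simp: link_invariant_def)
qed

lemma conn_word_set_head [simp]: "conn_word (set_head b w) = conn_word w"
  by (simp add: conn_word_def)

lemma num_blocks_Nil [simp]: "num_blocks [] = 0"
  by (simp add: num_blocks_def)

lemma num_blocks_append [simp]: "num_blocks (u @ v) = num_blocks u + num_blocks v"
  by (simp add: num_blocks_def)

lemma num_blocks_Cons [simp]: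
  "num_blocks (x # w) = of_bool (fst x) + of_bool (snd x = 0) + num_blocks w"
  by (simp add: num_blocks_def)

lemma num_blocks_set_head:
  "w \<noteq> [] \<Longrightarrow> fst (w ! 0) = (\<not> b) \<Longrightarrow>
    num_blocks (set_head b w) + of_bool (\<not> b) = num_blocks w + of_bool b"
  by (cases w) (auto simp: set_head_def)

lemma par_append1: "i < length u \<Longrightarrow> par (u @ v) i = par u i"
  by (simp add: par_def nth_append)

lemma par_append2:
  "closed_word v \<Longrightarrow> i < length v \<Longrightarrow> par (u @ v) (length u + i) = length u + par v i"
  by (simp add: par_def nth_append closed_word_def)

lemma par_le: "par w i \<le> i"
  by (simp add: par_def)

lemma link_invariant_const [simp]: "link_invariant w (\<lambda>_. c)"
  by (simp add: link_invariant_def)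

lemma link_invariant_cong:
  assumes "\<And>i. i < length w \<Longrightarrow> f i = g i"
  shows "link_invariant w f \<longleftrightarrow> link_invariant w g"
proof -
  have "((\<not> fst (w ! i) \<longrightarrow> f i = f (i - 1)) \<and> f i = f (par w i)) \<longleftrightarrow>
      ((\<not> fst (w ! i) \<longrightarrow> g i = g (i - 1)) \<and> g i = g (par w i))" if "i < length w" for i
    using assms[OF that] assms[of "i - 1"] assms[of "par w i"] that par_le[of w i] by auto
  then show ?thesis
    by (auto simp: link_invariant_def)
qed

lemma nc_wordD:
  "nc_word w \<Longrightarrow> j < length w \<Longrightarrow> i \<le> j \<Longrightarrow> par w j \<le> i \<Longrightarrow> par w j \<le> par w i"
  by (simp add: nc_word_def)

lemma nc_word_append:
  assumes "closed_word v"
  shows "nc_word (u @ v) \<longleftrightarrow> nc_word u \<and> nc_word v"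
proof
  assume nc: "nc_word (u @ v)"
  have "closed_word u"
    unfolding closed_word_def
  proof (intro allI impI)
    fix i assume "i < length u"
    moreover have "\<forall>i<length (u @ v). snd ((u @ v) ! i) \<le> i"
      using nc by (simp add: nc_word_def closed_word_def)
    ultimately have "snd ((u @ v) ! i) \<le> i" by simp
    then show "snd (u ! i) \<le> i"
      using \<open>i < length u\<close> by (simp add: nth_append)
  qed
  moreover have "par u j \<le> par u i" if "j < length u" "i \<le> j" "par u j \<le> i" for i j
    using nc_wordD[OF nc, of j i] that by (simp add: par_append1)
  moreover have "par v j \<le> par v i" if "j < length v" "i \<le> j" "par v j \<le> i" for i j
  proof -
    have "par (u @ v) (length u + j) \<le> par (u @ v) (length u + i)"
    proof -
      have "length u + j < length (u @ v)" "length u + i \<le> length u + j"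
        and "par (u @ v) (length u + j) \<le> length u + i"
        using that par_append2[OF assms that(1), of u] by simp_all
      then show ?thesis
        by (rule nc_wordD[OF nc])
    qed
    then show ?thesis
      using that by (simp add: par_append2[OF assms])
  qed
  ultimately show "nc_word u \<and> nc_word v"
    using assms by (auto simp: nc_word_def)
next
  assume nc: "nc_word u \<and> nc_word v"
  have "closed_word (u @ v)"
    unfolding closed_word_def
  proof (intro allI impI)
    fix i assume "i < length (u @ v)"
    moreover have "\<forall>i<length u. snd (u ! i) \<le> i" "\<forall>i<length v. snd (v ! i) \<le> i"
      using nc by (simp_all add: nc_word_def closed_word_def)
    ultimately show "snd ((u @ v) ! i) \<le> i"
      using le_trans[OF _ diff_le_self[of i "length u"]]
      by (cases "i < length u") (simp_all add: nth_append)
  qed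
  moreover have "par (u @ v) j \<le> par (u @ v) i"
    if "j < length (u @ v)" "i \<le> j" "par (u @ v) j \<le> i" for i j
  proof (cases "j < length u")
    case True
    then show ?thesis
      using nc that by (simp add: par_append1 nc_word_def)
  next
    case False
    then obtain j' where j: "j = length u + j'"
      using le_Suc_ex[of "length u" j] by auto
    have j': "j' < length v" and pj: "par (u @ v) j = length u + par v j'"
      using that j by (simp_all add: par_append2[OF assms])
    have "length u \<le> i"
      using that(3) pj by simp
    then obtain i' where i: "i = length u + i'"
      using le_Suc_ex by blast
    have "i' \<le> j'" "par v j' \<le> i'"
      using that pj i j by simp_all
    then have "par v j' \<le> par v i'"
      using nc_wordD[of v j' i'] nc j' by simp
    then show ?thesis
      using \<open>i' \<le> j'\<close> j' pj unfolding i j by (simp add: par_append2[OF assms])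
  qed
  ultimately show "nc_word (u @ v)"
    by (auto simp: nc_word_def)
qed

text \<open>Offsets in \<open>v\<close> stay inside \<open>v\<close>, so its first flag is the only
  possible link between the factors.\<close>

lemma link_invariant_append:
  assumes "closed_word v"
  shows "link_invariant (u @ v) f \<longleftrightarrow> link_invariant u f \<and> link_invariant v (\<lambda>i. f (length u + i)) \<and>
           (v \<noteq> [] \<and> \<not> fst (v ! 0) \<longrightarrow> f (length u) = f (length u - 1))"
    (is "_ \<longleftrightarrow> _ \<and> _ \<and> ?glue")
proof -
  let ?P = "\<lambda>i. (\<not> fst ((u @ v) ! i) \<longrightarrow> f i = f (i - 1)) \<and> f i = f (par (u @ v) i)"
  have split: "(\<forall>i<length (u @ v). ?P i) \<longleftrightarrow>
      (\<forall>i<length u. ?P i) \<and> (\<forall>i<length v. ?P (length u + i))" (is "?l \<longleftrightarrow> ?r")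
  proof
    assume r: ?r
    show ?l
    proof (intro allI impI)
      fix i assume "i < length (u @ v)"
      then have "i < length u \<or> (\<exists>k. i = length u + k \<and> k < length v)"
        using le_Suc_ex[of "length u" i] by fastforce
      then show "?P i"
        using r by auto
    qed
  qed auto
  have left: "(\<forall>i<length u. ?P i) = link_invariant u f"
    unfolding link_invariant_def by (auto simp: nth_append par_append1)
  have right: "(\<forall>i<length v. ?P (length u + i)) \<longleftrightarrow> link_invariant v (\<lambda>i. f (length u + i)) \<and> ?glue"
    (is "?l \<longleftrightarrow> ?r")
  proof
    assume l: ?l
    have "link_invariant v (\<lambda>i. f (length u + i))"
      unfolding link_invariant_def
    proof (intro allI impI conjI)
      fix i assume i: "i < length v"
      show "f (length u + i) = f (length u + (i - 1))" if "\<not> fst (v ! i)"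
      proof (cases i)
        case (Suc k)
        have "f (length u + i) = f (length u + i - 1)"
          using l[rule_format, THEN conjunct1, OF i] that unfolding nth_append_length_plus by blast
        then show ?thesis using Suc by simp
      qed simp
      show "f (length u + i) = f (length u + par v i)"
        using l i by (simp add: par_append2[OF assms])
    qed
    moreover have ?glue
      using l by (auto dest: spec[of _ 0])
    ultimately show ?r ..
  next
    assume r: ?r
    show ?l
    proof (intro allI impI conjI)
      fix i assume i: "i < length v"
      have comp: "(\<not> fst (v ! i) \<longrightarrow> f (length u + i) = f (length u + (i - 1))) \<and>
          f (length u + i) = f (length u + par v i)"
        using r i unfolding link_invariant_def by auto
      show "f (length u + i) = f (length u + i - 1)" if "\<not> fst ((u @ v) ! (length u + i))"
        using r comp i that unfolding nth_append_length_plus by (cases i) auto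
      show "f (length u + i) = f (par (u @ v) (length u + i))"
        using comp i by (simp add: par_append2[OF assms])
    qed
  qed
  show ?thesis
    using split left right unfolding link_invariant_def[of "u @ v"] by blast
qed

lemma link_invariant_snoc:
  "link_invariant (u @ [x]) f \<longleftrightarrow> link_invariant u f \<and>
     (\<not> fst x \<longrightarrow> f (length u) = f (length u - 1)) \<and> f (length u) = f (length u - snd x)"
proof -
  let ?P = "\<lambda>w i. (\<not> fst (w ! i) \<longrightarrow> f i = f (i - 1)) \<and> f i = f (par w i)"
  have "?P (u @ [x]) i \<longleftrightarrow> ?P u i" if "i < length u" for i
    unfolding par_append1[OF that] using that by (simp only: nth_append if_True)
  then have "link_invariant u f \<longleftrightarrow> (\<forall>i<length u. ?P (u @ [x]) i)"
    unfolding link_invariant_def by blast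
  moreover have "link_invariant (u @ [x]) f \<longleftrightarrow> ?P (u @ [x]) (length u) \<and> (\<forall>i<length u. ?P (u @ [x]) i)"
    unfolding link_invariant_def length_append_singleton All_less_Suc ..
  moreover have "?P (u @ [x]) (length u) \<longleftrightarrow>
      (\<not> fst x \<longrightarrow> f (length u) = f (length u - 1)) \<and> f (length u) = f (length u - snd x)"
    unfolding par_def nth_append_length ..
  ultimately show ?thesis by blast
qed

lemma link_invariant_snoc_root:
  assumes "n = length u"
  shows "link_invariant (u @ [(b, n)]) f \<longleftrightarrow>
     link_invariant u f \<and> (\<not> b \<longrightarrow> f n = f (n - 1)) \<and> f n = f 0"
  unfolding link_invariant_snoc assms by simp

text \<open>An arc from the last position back to 0 spans the whole word and crosses
  nothing.\<close>

lemma nc_word_snoc_root: "n = length u \<Longrightarrow> nc_word (u @ [(b, n)]) \<longleftrightarrow> nc_word u"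
proof (hypsubst)
  have "par (u @ [(b, length u)]) (length u) = 0"
    by (simp add: par_def)
  then show "nc_word (u @ [(b, length u)]) \<longleftrightarrow> nc_word u"
    unfolding nc_word_def closed_word_def
    by (auto simp: less_Suc_eq nth_append par_append1)
qed

lemma closed_word_drop:
  assumes "closed_word w" "\<And>j. m \<le> j \<Longrightarrow> j < length w \<Longrightarrow> m \<le> par w j"
  shows "closed_word (drop m w)"
  unfolding closed_word_def
proof (intro allI impI)
  fix i assume i: "i < length (drop m w)"
  have "m \<le> par w (m + i)" "snd (w ! (m + i)) \<le> m + i"
    using assms(2)[of "m + i"] assms(1) i by (auto simp: closed_word_def)
  then show "snd (drop m w ! i) \<le> i"
    using i by (simp add: par_def)
qed

lemma conn_wordD: "conn_word w \<Longrightarrow> link_invariant w (f :: nat \<Rightarrow> bool) \<Longrightarrow> i < length w \<Longrightarrow> f i = f 0"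
  by (auto simp: conn_word_def)

lemma conn_word_const:
  assumes "conn_word w" "link_invariant w (f :: nat \<Rightarrow> bool)" "i < length w" "j < length w"
  shows "f i = f j"
  using conn_wordD[OF assms(1,2,3)] conn_wordD[OF assms(1,2,4)] by simp

text \<open>A graph with \<open>e\<close> edges on \<open>v\<close> vertices has at least \<open>v - e\<close> components.\<close>

lemma exists_link_invariant_many_values:
  assumes "closed_word w"
  shows "\<exists>f :: nat \<Rightarrow> nat. link_invariant w f \<and> num_blocks w \<le> card (f ` {..<length w}) + length w"
  using assms
proof (induction w rule: rev_induct)
  case Nil
  then show ?case by (simp add: link_invariant_def)
next
  case (snoc x w)
  let ?n = "length w" and ?w = "w @ [x]"
  have cl: "closed_word w" and sx: "snd x \<le> ?n"
    using snoc.prems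
    by (auto simp: closed_word_def nth_append dest: spec[of _ ?n]) (metis less_Suc_eq)
  obtain f :: "nat \<Rightarrow> nat" where f: "link_invariant w f" "num_blocks w \<le> card (f ` {..<?n}) + ?n"
    using snoc.IH[OF cl] by blast
  show ?case
  proof (cases "?n = 0")
    case True
    then show ?thesis
      using sx by (intro exI[of _ "\<lambda>_. 0"]) (auto simp: link_invariant_def of_bool_def)
  next
    case False
    \<comment> \<open>The new position gets colour \<open>c\<close>: a fresh one if it begins both
      blocks, otherwise that of a position to which it is linked. If it is linked to a second one,
      of colour \<open>d\<close>, then \<open>h\<close> identifies the two colours.\<close>
    define c where "c = (if fst x \<and> snd x = 0 then Suc (Max (f ` {..<?n}))
        else if fst x then f (?n - snd x) else f (?n - 1))"
    define d where "d = (if snd x = 0 then c else f (?n - snd x))"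
    define h where "h = (\<lambda>v. if v = d then c else v)"
    define g where "g i = (if i = ?n then c else h (f i))" for i
    have "link_invariant w (\<lambda>i. h (f i))"
      using f(1) unfolding link_invariant_def by metis
    then have "link_invariant w g"
      using link_invariant_cong[of w g "\<lambda>i. h (f i)"] by (simp add: g_def)
    moreover have "g ?n = g (?n - snd x)"
      using False by (auto simp: g_def h_def d_def)
    moreover have "\<not> fst x \<longrightarrow> g ?n = g (?n - 1)"
      using False by (auto simp: g_def h_def c_def)
    ultimately have compat: "link_invariant ?w g"
      by (simp add: link_invariant_snoc)
    have img: "g ` {..<length ?w} = insert c (h ` f ` {..<?n})"
      by (auto simp: g_def image_iff lessThan_Suc)
    have fin: "finite (f ` {..<?n})" by simp
    have hsub: "card (f ` {..<?n}) \<le> card (insert d (h ` f ` {..<?n}))"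
      by (intro card_mono) (auto simp: h_def)
    have "card (f ` {..<?n}) + of_bool (fst x) + of_bool (snd x = 0)
        \<le> card (g ` {..<length ?w}) + 1"
    proof (cases "snd x = 0")
      case s0: True
      then have h_id: "h = id"
        by (auto simp: h_def d_def)
      show ?thesis
      proof (cases "fst x")
        case True
        then have "c \<notin> f ` {..<?n}"
          using s0 Max_ge[OF fin] by (fastforce simp: c_def)
        then show ?thesis
          unfolding img h_id using s0 by simp
      next
        case False
        then show ?thesis
          unfolding img h_id using s0 card_mono[of "insert c (f ` {..<?n})" "f ` {..<?n}"]
          by auto
      qed
    next
      case sn: False
      show ?thesis
      proof (cases "fst x")
        case True
        then have "c = d"
          using sn by (simp add: c_def d_def)
        then show ?thesis
          unfolding img using hsub sn by simp
      next
        case False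
        have "card (insert d (h ` f ` {..<?n})) \<le> card (h ` f ` {..<?n}) + 1"
          by (simp add: card_insert_if)
        also have "card (h ` f ` {..<?n}) \<le> card (g ` {..<length ?w})"
          unfolding img by (intro card_mono) auto
        finally show ?thesis
          using hsub sn False by simp
      qed
    qed
    then show ?thesis
      using compat f(2) by (intro exI[of _ g]) auto
  qed
qed

text \<open>On a connected word the colouring with many values has at most one value, which leaves
  at most one vertex more than edges.\<close>

lemma num_blocks_le:
  assumes "closed_word w" "conn_word w"
  shows "num_blocks w \<le> length w + 1"
proof -
  obtain f :: "nat \<Rightarrow> nat" where f: "link_invariant w f" "num_blocks w \<le> card (f ` {..<length w}) + length w"
    using exists_link_invariant_many_values[OF assms(1)] by blast
  have "link_invariant w (\<lambda>i. f i = f 0)"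
    using f(1) by (auto simp: link_invariant_def)
  then have "f ` {..<length w} \<subseteq> {f 0}"
    using conn_wordD[OF assms(2)] by fastforce
  then have "card (f ` {..<length w}) \<le> 1"
    by (metis card.empty card_insert_disjoint card_mono empty_iff finite.emptyI finite.insertI One_nat_def)
  then show ?thesis
    using f(2) by simp
qed

section \<open>Building tree words from smaller ones and cutting them\<close>

text \<open>The counterpart of \<open>1 + T\<close>.\<close>

definition tree_or_Nil :: "(bool \<times> nat) list \<Rightarrow> bool" where
  "tree_or_Nil w \<longleftrightarrow> w = [] \<or> tree_word w"

text \<open>The middle letter is the last element of the block of 0. If \<open>b\<close> is
  nonempty, its flag links it to \<open>b\<close>; otherwise its predecessor, if any, lies in
  \<open>a\<close>, to which the offset links it already, and a second link would close a cycle.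
  \<open>c\<close> hangs on the interval block of this letter.\<close>

definition graft :: "(bool \<times> nat) list \<Rightarrow> (bool \<times> nat) list \<Rightarrow> (bool \<times> nat) list \<Rightarrow> (bool \<times> nat) list" where
  "graft a b c = ((a @ b) @ [(b = [], length (a @ b))]) @ set_head False c"

lemma set_head_Nil [simp]: "set_head b [] = []"
  by (simp add: set_head_def)

lemma length_graft [simp]: "length (graft a b c) = length a + length b + length c + 1"
  by (simp add: graft_def)

lemma nc_word_Nil [simp]: "nc_word []"
  by (simp add: nc_word_def closed_word_def)

lemma nc_word_imp_closed: "nc_word w \<Longrightarrow> closed_word w"
  by (simp add: nc_word_def)

lemma tree_or_NilD:
  assumes "tree_or_Nil w"
  shows "nc_word w" "closed_word w" "conn_word w" "w \<noteq> [] \<Longrightarrow> fst (w ! 0)"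
    "num_blocks w = length w + of_bool (w \<noteq> [])"
  using assms by (auto simp: tree_or_Nil_def tree_word_def nc_word_imp_closed conn_word_def)

text \<open>Each nonempty part is attached to the middle letter by exactly one link, so
  connectedness and the surplus of one vertex are both preserved.\<close>

lemma tree_word_graft:
  assumes a: "tree_or_Nil a" and b: "tree_or_Nil b" and c: "tree_or_Nil c"
    and ab: "a = [] \<Longrightarrow> b = []"
  shows "tree_word (graft a b c)"
  unfolding tree_word_def
proof (intro conjI)
  note A = tree_or_NilD[OF a] and B = tree_or_NilD[OF b] and C = tree_or_NilD[OF c]
  let ?n = "length a + length b"
  show "graft a b c \<noteq> []"
    by (simp add: graft_def)
  show "fst (graft a b c ! 0)"
    using A(4) ab by (cases "a = []") (auto simp: graft_def nth_append)
  show "nc_word (graft a b c)"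
    using A B C unfolding graft_def
    by (simp add: nc_word_append nc_word_snoc_root del: append_assoc length_append)
  show "conn_word (graft a b c)"
    unfolding conn_word_def
  proof (intro allI impI)
    fix f :: "nat \<Rightarrow> bool" and i
    assume f: "link_invariant (graft a b c) f" and i: "i < length (graft a b c)"
    have "link_invariant ((a @ b) @ [(b = [], length (a @ b))]) f"
      and cc: "link_invariant c (\<lambda>i. f (?n + 1 + i))"
      and glue: "c \<noteq> [] \<Longrightarrow> f (?n + 1) = f ?n"
      using f C(2) unfolding graft_def
      by (auto simp: link_invariant_append fst_set_head simp del: append_assoc)
    then have "link_invariant (a @ b) f" and root: "f ?n = f 0"
      and last: "b \<noteq> [] \<Longrightarrow> f ?n = f (?n - 1)"
      by (auto simp: link_invariant_snoc_root simp del: append_assoc)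
    then have ca: "link_invariant a f" and cb: "link_invariant b (\<lambda>i. f (length a + i))"
      using B(2) by (auto simp: link_invariant_append)
    consider "i < length a" | k where "i = length a + k" "k < length b" | "i = ?n"
      | k where "i = ?n + 1 + k" "k < length c"
    proof -
      have "i < length a \<or> (\<exists>k. i = length a + k \<and> k < length b) \<or> i = ?n \<or>
          (\<exists>k. i = ?n + 1 + k \<and> k < length c)"
        using i by simp presburger
      then show ?thesis using that by blast
    qed
    then show "f i = f 0"
    proof cases
      case 1
      then show ?thesis using conn_wordD[OF A(3) ca] by blast
    next
      case 2
      then have "f i = f (length a + (length b - 1))"
        using conn_word_const[OF B(3) cb, of k "length b - 1"] by simp
      also have "\<dots> = f ?n"
        using last 2 by (metis Nat.add_diff_assoc One_nat_def Suc_leI list.size(3) not_gr_zero not_less_zero)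
      finally show ?thesis using root by simp
    next
      case 3
      then show ?thesis using root by simp
    next
      case 4
      then have "f i = f (?n + 1)"
        using conn_wordD[OF C(3) cc, of k] by simp
      then show ?thesis
        using glue root 4 by (metis list.size(3) not_less_zero)
    qed
  qed
  have "num_blocks (set_head False c) = length c"
    using num_blocks_set_head[of c False] C(4,5) by (cases "c = []") auto
  then show "num_blocks (graft a b c) = length (graft a b c) + 1"
    using A(5) B(5) ab by (auto simp: graft_def)
qed

text \<open>The last element \<open>m\<close> of the block of \<open>0\<close> splits off \<open>c\<close> to its right. To its left there
  are at most two components, as each of them must contain \<open>0\<close> or the predecessor of \<open>m\<close>.\<close>

lemma tree_word_decompose:
  assumes w: "tree_word w"
  shows "\<exists>a b c. tree_or_Nil a \<and> tree_or_Nil b \<and> tree_or_Nil c \<and> (a = [] \<longrightarrow> b = []) \<and>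
           w = graft a b c"
proof -
  have ne: "w \<noteq> []" and head: "fst (w ! 0)" and nc: "nc_word w" and conn: "conn_word w"
    and count: "num_blocks w = length w + 1"
    using w by (auto simp: tree_word_def)
  note cl = nc_word_imp_closed[OF nc]
  define m where "m = (GREATEST i. i < length w \<and> par w i = 0)"
  have ex: "0 < length w \<and> par w 0 = 0"
    using ne by (simp add: par_def)
  have m: "m < length w" "par w m = 0"
    unfolding m_def using GreatestI_nat[of "\<lambda>i. i < length w \<and> par w i = 0" 0 "length w"] ex by auto
  have m_max: "i \<le> m" if "i < length w" "par w i = 0" for i
    unfolding m_def using that by (intro Greatest_le_nat[of _ _ "length w"]) auto
  define u z b where "u = take m w" and "z = drop (Suc m) w" and "b = fst (w ! m)"
  have lu: "length u = m"
    using m by (simp add: u_def)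
  have "w ! m = (b, m)"
    using m cl by (auto simp: b_def par_def closed_word_def prod_eq_iff)
  then have w_eq: "w = (u @ [(b, length u)]) @ z"
    unfolding lu using \<open>w ! m = (b, m)\<close>
    by (subst id_take_nth_drop[OF m(1)]) (simp add: u_def z_def)
  \<comment> \<open>By nesting, an arc from \<open>j\<close> over \<open>m\<close> would start at 0,
    against the choice of \<open>m\<close>.\<close>
  have right: "Suc m \<le> par w j" if "Suc m \<le> j" "j < length w" for j
  proof (rule ccontr)
    assume "\<not> Suc m \<le> par w j"
    then have "par w j \<le> par w m"
      using nc that unfolding nc_word_def by auto
    then show False
      using m m_max[of j] that by simp
  qed
  have clz: "closed_word z"
    unfolding z_def using cl right by (rule closed_word_drop)
  have nc_u: "nc_word u" and nc_z: "nc_word z"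
    using nc clz unfolding w_eq by (simp_all add: nc_word_append nc_word_snoc_root del: append_assoc)
  have head_u: "u \<noteq> [] \<Longrightarrow> fst (u ! 0)"
    using head lu by (simp add: u_def)
  have comp_iff: "link_invariant w f \<longleftrightarrow> link_invariant u f \<and> (\<not> b \<longrightarrow> f m = f (m - 1)) \<and> f m = f 0 \<and>
      link_invariant z (\<lambda>i. f (Suc m + i)) \<and> (z \<noteq> [] \<and> \<not> fst (z ! 0) \<longrightarrow> f (Suc m) = f m)"
    for f :: "nat \<Rightarrow> bool"
    using clz unfolding w_eq
    by (simp add: link_invariant_append link_invariant_snoc_root lu del: append_assoc)
  have const: "f i = f 0" if "link_invariant w f" "i < length w" for f :: "nat \<Rightarrow> bool" and i
    using conn_wordD[OF conn that] .
  have len_w: "length w = m + 1 + length z"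
    by (subst w_eq) (simp add: lu)
  have link_invariant_u: "link_invariant u f \<longleftrightarrow> link_invariant u g" if "\<And>i. i < m \<Longrightarrow> f i = g i"
    for f g :: "nat \<Rightarrow> bool"
    using link_invariant_cong[of u f g] that lu by simp
  have z_head: "\<not> fst (z ! 0)" if "z \<noteq> []"
  proof
    assume "fst (z ! 0)"
    then have "link_invariant w (\<lambda>i. i < Suc m)"
      using that link_invariant_u[of "\<lambda>i. i < Suc m" "\<lambda>_. True"] diff_le_self[of m 1]
      by (simp add: comp_iff less_Suc_eq_le)
    then show False
      using const[of "\<lambda>i. i < Suc m" "Suc m"] that len_w by simp
  qed
  define c where "c = set_head True z"
  have zc: "z = set_head False c"
    unfolding c_def using z_head by (simp add: set_head_id)
  have conn_z: "conn_word z"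
    unfolding conn_word_def
  proof (intro allI impI)
    fix f :: "nat \<Rightarrow> bool" and i
    assume f: "link_invariant z f" and i: "i < length z"
    define g where "g i = (if i < Suc m then f 0 else f (i - Suc m))" for i
    have "link_invariant w g"
      using f link_invariant_u[of g "\<lambda>_. f 0"] by (simp add: comp_iff g_def)
    then have "g (Suc m + i) = g 0"
      using const i len_w by simp
    then show "f i = f 0"
      by (simp add: g_def)
  qed
  have conn_c: "conn_word c" and nc_c: "nc_word c"
    using conn_z nc_z by (simp_all add: c_def)
  have blocks_c: "num_blocks c = num_blocks z + of_bool (z \<noteq> [])"
    using num_blocks_set_head[of z True] z_head by (cases "z = []") (auto simp: c_def)
  have len_c: "length c = length z" by (simp add: c_def)
  have c_nil: "c = [] \<longleftrightarrow> z = []" by (simp add: c_def)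
  have "num_blocks c \<le> length c + 1"
    using num_blocks_le conn_c nc_c by (simp add: nc_word_imp_closed)
  then have blocks_c_le: "num_blocks c \<le> length c + of_bool (c \<noteq> [])"
    by (cases "c = []") auto
  then have blocks_z: "num_blocks z \<le> length z"
    using blocks_c len_c c_nil by simp
  have blocks_w: "num_blocks u + of_bool b + of_bool (m = 0) + num_blocks z = m + length z + 2"
    using count unfolding w_eq by (simp add: lu)
  have tree_c: "tree_or_Nil c" if "num_blocks c = length c + of_bool (c \<noteq> [])"
    using that conn_c nc_c by (auto simp: tree_or_Nil_def tree_word_def c_def fst_set_head)
  show ?thesis
  proof (cases "m = 0")
    case True
    then have "u = []" "b"
      using lu head by (auto simp: b_def)
    then have "num_blocks c = length c + of_bool (c \<noteq> [])"
      using blocks_w blocks_c True len_c c_nil by simp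
    moreover have "w = graft [] [] c"
      using \<open>u = []\<close> \<open>b\<close> by (subst w_eq) (simp add: graft_def zc)
    ultimately show ?thesis
      using tree_c by (intro exI[of _ "[]"] exI[of _ c]) (auto simp: tree_or_Nil_def)
  next
    case False
    then have u_ne: "u \<noteq> []" using lu by auto
    \<comment> \<open>All that \<open>m\<close> demands of an invariant function on \<open>u\<close>
      is to agree at 0 and, unless \<open>m\<close> begins an interval block, at
      \<open>m - 1\<close>. Such a function extends to \<open>w\<close> and is therefore
      constant.\<close>
    have extend: "f i = f 0"
      if f: "link_invariant u f" "\<not> b \<longrightarrow> f 0 = f (m - 1)" and i: "i < m" for f :: "nat \<Rightarrow> bool" and i
    proof -
      define g where "g i = (if i < m then f i else f 0)" for i
      have "link_invariant w g"
        using f False link_invariant_u[of g f] by (simp add: comp_iff g_def)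
      then have "g i = g 0"
        using const i len_w by simp
      then show ?thesis
        using i False by (simp add: g_def)
    qed
    show ?thesis
    proof (cases "conn_word u")
      case True
      then have "num_blocks u \<le> m + 1"
        using num_blocks_le nc_u lu by (metis nc_word_imp_closed)
      \<comment> \<open>The prescribed total is reached only if \<open>m\<close> carries a flag and
        both \<open>u\<close> and \<open>c\<close> have as many blocks as connectedness
        permits.\<close>
      then have b and bu: "num_blocks u = m + 1" and "num_blocks c = length c + of_bool (c \<noteq> [])"
        using blocks_w blocks_z blocks_c len_c c_nil False by (cases b; simp)+
      moreover have "tree_word u"
        using True u_ne head_u nc_u bu lu by (simp add: tree_word_def)
      moreover have "w = graft u [] c"
        using \<open>b\<close> by (subst w_eq) (simp add: graft_def zc)
      ultimately show ?thesis
        using tree_c u_ne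
        by (intro exI[of _ u] exI[of _ "[]"] exI[of _ c]) (auto simp: tree_or_Nil_def)
    next
      case not_conn: False
      then have nb: "\<not> b"
        using extend lu unfolding conn_word_def by metis
      obtain f where f: "link_invariant u f" "\<not> f 0" "f (m - 1)"
      proof -
        obtain g :: "nat \<Rightarrow> bool" and i where g: "link_invariant u g" "i < m" "g i \<noteq> g 0"
          using not_conn lu unfolding conn_word_def by metis
        then have "g 0 \<noteq> g (m - 1)"
          using extend by blast
        moreover have "link_invariant u (\<lambda>i. g i \<noteq> g 0)"
          using g(1) by (auto simp: link_invariant_def)
        ultimately show ?thesis
          using that[of "\<lambda>i. g i \<noteq> g 0"] by simp
      qed
      \<comment> \<open>\<open>f\<close> separates \<open>m - 1\<close> from 0; \<open>u\<close> is
        cut at the first position on the side of \<open>m - 1\<close>.\<close>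
      define k where "k = (LEAST i. f i)"
      have k: "f k" "k \<le> m - 1" "\<And>i. i < k \<Longrightarrow> \<not> f i"
        unfolding k_def using f(3) by (auto intro: LeastI Least_le dest: not_less_Least)
      have km: "k < m" "0 < k"
        using k f(2) False by (auto intro: gr0I)
      have fu: "\<not> fst (u ! i) \<Longrightarrow> f i = f (i - 1)" "f i = f (par u i)" if "i < m" for i
        using f(1) that lu by (auto simp: link_invariant_def)
      have bit_k: "fst (u ! k)"
        using fu(1)[OF km(1)] k(1) k(3)[of "k - 1"] km by auto
      have par_k: "k \<le> par u j" if "k \<le> j" "j < m" for j
      proof (rule ccontr)
        assume pj: "\<not> k \<le> par u j"
        define p where "p = par u j"
        have p: "p < k" "\<not> f p" "\<not> f j"
          using pj k(3) fu(2)[OF that(2)] by (auto simp: p_def)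
        have mj: "j < m - 1"
          using p(3) f(3) that(2) by (metis Suc_pred' bot_nat_0.not_eq_extremum False less_antisym)
        \<comment> \<open>An arc from \<open>j\<close> back to \<open>p\<close> over the cut belongs
          to the side of 0 and isolates what lies beneath it on the other side: \<open>f\<close>
          restricted to that range is invariant, false at 0 and at \<open>m - 1\<close>, but true at
          \<open>k\<close>.\<close>
        define g where "g i = (f i \<and> p < i \<and> i \<le> j)" for i
        have "link_invariant u g"
          unfolding link_invariant_def
        proof (intro allI impI conjI)
          fix i assume "i < length u"
          then have i: "i < m" by (simp add: lu)
          show "g i = g (i - 1)" if "\<not> fst (u ! i)"
          proof -
            have "f i = f (i - 1)" using fu(1)[OF i that] .
            then show ?thesis
              using p unfolding g_def
              by (cases i; cases "i - 1 = p"; cases "i - 1 = j") auto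
          qed
          have le: "par u i \<le> i" by (rule par_le)
          have fi: "f i = f (par u i)" using fu(2)[OF i] .
          show "g i = g (par u i)"
          proof (cases "i \<le> j")
            case True
            show ?thesis
            proof (cases "p < i")
              case pi: True
              have "p \<le> par u i"
                using nc_u pi True that lu unfolding nc_word_def p_def by simp
              then have "p < par u i \<or> \<not> f i"
                using fi p by (cases "p = par u i") auto
              then show ?thesis
                using pi True le fi by (auto simp: g_def)
            next
              case False
              then show ?thesis using le by (auto simp: g_def)
            qed
          next
            case ij: False
            have "\<not> (p < par u i \<and> par u i \<le> j)"
            proof
              assume pp: "p < par u i \<and> par u i \<le> j"
              then have "par u i \<le> par u j"
                using nc_u ij i lu unfolding nc_word_def by simp
              then show False using pp by (simp add: p_def)
            qed
            then show ?thesis using ij by (auto simp: g_def)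
          qed
        qed
        moreover have "g 0 = g (m - 1)"
          using mj by (simp add: g_def)
        ultimately have "g k = g 0"
          using extend km by blast
        then show False
          using p k(1) that(1) by (simp add: g_def)
      qed
      define a d where "a = take k u" and "d = drop k u"
      have u_eq: "u = a @ d" by (simp add: a_def d_def)
      have la: "length a = k" and ld: "length d = m - k"
        using km lu by (auto simp: a_def d_def)
      have cld: "closed_word d"
        unfolding d_def using nc_word_imp_closed[OF nc_u] par_k lu by (intro closed_word_drop) auto
      have nc_a: "nc_word a" and nc_d: "nc_word d"
        using nc_u cld by (simp_all add: u_eq nc_word_append)
      have ne_ad: "a \<noteq> []" "d \<noteq> []"
        using la ld km by auto
      have heads: "fst (a ! 0)" "fst (d ! 0)"
        using head_u u_ne bit_k km lu by (auto simp: a_def d_def)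
      have comp_u: "link_invariant u g \<longleftrightarrow> link_invariant a g \<and> link_invariant d (\<lambda>i. g (k + i))"
        for g :: "nat \<Rightarrow> bool"
        unfolding u_eq using cld heads by (simp add: link_invariant_append la)
      have conn_a: "conn_word a"
        unfolding conn_word_def
      proof (intro allI impI)
        fix h :: "nat \<Rightarrow> bool" and i
        assume h: "link_invariant a h" and i: "i < length a"
        \<comment> \<open>Continuing with the value at 0 gives equal values at both ends, as
          \<open>extend\<close> requires; for \<open>d\<close> the value at \<open>m - 1\<close> is
          continued to the left instead.\<close>
        define g where "g i = (if i < k then h i else h 0)" for i
        have "link_invariant a g"
          using h link_invariant_cong[of a g h] la by (simp add: g_def)
        then have "link_invariant u g"
          by (simp add: comp_u) (simp add: g_def)
        moreover have "g 0 = g (m - 1)"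
          using km by (simp add: g_def)
        ultimately have "g i = g 0"
          using extend[of g i] i la km by simp
        then show "h i = h 0"
          using i la by (simp add: g_def)
      qed
      have conn_d: "conn_word d"
        unfolding conn_word_def
      proof (intro allI impI)
        fix h :: "nat \<Rightarrow> bool" and i
        assume h: "link_invariant d h" and i: "i < length d"
        define g where "g i = (if i < k then h (m - 1 - k) else h (i - k))" for i
        have "link_invariant u g"
          using h link_invariant_cong[of a g "\<lambda>_. h (m - 1 - k)"] la by (simp add: comp_u g_def)
        moreover have "g 0 = g (m - 1)"
          using km by (simp add: g_def)
        ultimately have const_g: "j < m \<Longrightarrow> g j = g 0" for j
          using extend[of g j] by simp
        have "g (k + i) = g 0" "g k = g 0"
          using i ld km by (auto intro!: const_g)
        then show "h i = h 0"
          by (simp add: g_def)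
      qed
      have "num_blocks a \<le> k + 1" "num_blocks d \<le> m - k + 1"
        using num_blocks_le[OF nc_word_imp_closed[OF nc_a] conn_a]
          num_blocks_le[OF nc_word_imp_closed[OF nc_d] conn_d] la ld by simp_all
      moreover have "num_blocks a + num_blocks d + num_blocks z = m + length z + 2"
        using blocks_w nb False by (simp add: u_eq)
      ultimately have na: "num_blocks a = k + 1" and nd: "num_blocks d = m - k + 1"
        and nz: "num_blocks c = length c + of_bool (c \<noteq> [])"
        using blocks_z blocks_c len_c c_nil km by simp_all
      have "w = graft a d c"
        using nb ne_ad by (subst w_eq) (simp add: graft_def zc u_eq)
      moreover have "tree_word a" "tree_word d"
        using ne_ad heads nc_a nc_d conn_a conn_d na nd la ld by (auto simp: tree_word_def)
      ultimately show ?thesis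
        using tree_c[OF nz] ne_ad
        by (intro exI[of _ a] exI[of _ d] exI[of _ c]) (auto simp: tree_or_Nil_def)
    qed
  qed
qed

lemma not_conn_word_append:
  assumes "closed_word v" "v \<noteq> []" "fst (v ! 0)" "u \<noteq> []"
  shows "\<not> conn_word (u @ v)"
proof
  assume conn: "conn_word (u @ v)"
  have "link_invariant (u @ v) (\<lambda>i. i < length u)"
    unfolding link_invariant_append[OF assms(1)] using assms(3)
    by (auto simp: link_invariant_def le_less_trans[OF par_le])
  from conn_wordD[OF conn this, of "length u"] show False
    using assms by simp
qed

text \<open>The middle letter is the last position linked to 0 by its offset, which fixes
  \<open>a @ b\<close> and \<open>c\<close>. If the border between \<open>a\<close> and
  \<open>b\<close> could move, the longer first part would end in a closed factor that begins an
  interval block, and so be disconnected.\<close>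

lemma graft_inject:
  assumes eq: "graft a b c = graft a' b' c'"
    and t: "tree_or_Nil a" "tree_or_Nil b" "tree_or_Nil c" "tree_or_Nil a'" "tree_or_Nil b'" "tree_or_Nil c'"
    and ab: "a = [] \<longrightarrow> b = []" "a' = [] \<longrightarrow> b' = []"
  shows "a = a' \<and> b = b' \<and> c = c'"
proof -
  have root: "par (graft a b c) (length (a @ b)) = 0" for a b c
    by (simp add: graft_def par_def nth_append)
  have right: "par (graft a b c) j \<noteq> 0"
    if tc: "tree_or_Nil c" and j: "length (a @ b) < j" "j < length (graft a b c)" for a b c j
  proof -
    let ?u = "(a @ b) @ [(b = [], length (a @ b))]"
    obtain k where k: "j = length ?u + k" "k < length c"
      using j le_Suc_ex[of "length ?u" j] by auto
    have "par (?u @ set_head False c) (length ?u + k) = length ?u + par (set_head False c) k"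
      using k tree_or_NilD(2)[OF tc] by (intro par_append2) auto
    then show ?thesis
      by (simp add: graft_def k(1))
  qed
  have len_le: "length (a' @ b') \<le> length (a @ b)"
    if "graft a b c = graft a' b' c'" "tree_or_Nil c" for a b c a' b' c'
  proof (rule ccontr)
    assume "\<not> length (a' @ b') \<le> length (a @ b)"
    then have "par (graft a b c) (length (a' @ b')) \<noteq> 0"
      by (intro right) (use that in simp_all)
    then show False
      using root[of a' b' c'] that(1) by simp
  qed
  have len: "length (a @ b) = length (a' @ b')"
    using len_le[OF eq t(3)] len_le[OF eq[symmetric] t(6)] by (rule antisym[rotated])
  have "(a @ b) @ [(b = [], length (a @ b))] = (a' @ b') @ [(b' = [], length (a' @ b'))] \<and>
      set_head False c = set_head False c'"
    using eq len unfolding graft_def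
    by (subst (asm) append_eq_append_conv) (simp_all del: append_assoc)
  then have abeq: "a @ b = a' @ b'" and nil: "b = [] \<longleftrightarrow> b' = []"
    and "set_head False c = set_head False c'"
    by (simp_all del: append_assoc length_append)
  then have "set_head True (set_head False c) = set_head True (set_head False c')"
    by simp
  then have "c = c'"
    using tree_or_NilD(4)[OF t(3)] tree_or_NilD(4)[OF t(6)] by (simp add: set_head_id)
  moreover have "\<not> length a < length a'"
    if eq': "a @ b = a' @ b'" and "b' \<noteq> []" and t': "tree_or_Nil a'" "tree_or_Nil b"
      and nil': "a = [] \<longrightarrow> b = []" for a b a' b'
  proof
    assume "length a < length a'"
    then obtain d where d: "a' = a @ d" "b = d @ b'" "d \<noteq> []"
      using eq' by (auto simp: append_eq_append_conv2)
    have "fst (d ! 0)"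
      using tree_or_NilD(4)[OF t'(2)] d by (simp add: nth_append)
    moreover have "closed_word d"
      unfolding closed_word_def
    proof (intro allI impI)
      fix i assume "i < length d"
      then show "snd (d ! i) \<le> i"
        using tree_or_NilD(2)[OF t'(2)] d unfolding closed_word_def
        by (auto simp: nth_append dest!: spec[of _ i])
    qed
    moreover have "a \<noteq> []"
      using nil' d by auto
    ultimately have "\<not> conn_word a'"
      using not_conn_word_append[of d a] d by simp
    then show False
      using tree_or_NilD(3)[OF t'(1)] by contradiction
  qed
  then have "length a = length a'"
    using abeq nil t ab by (metis append_Nil2 linorder_neqE_nat)
  ultimately show ?thesis
    using abeq by simp
qed

section \<open>Counting tree words\<close>

definition tree_words :: "nat \<Rightarrow> (bool \<times> nat) list set" where
  "tree_words n = {w. tree_word w \<and> length w = n}"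

definition tree_or_Nil_words :: "nat \<Rightarrow> (bool \<times> nat) list set" where
  "tree_or_Nil_words n = {w. tree_or_Nil w \<and> length w = n}"

lemma finite_tree_or_Nil_words: "finite (tree_or_Nil_words n)"
proof (rule finite_subset)
  show "tree_or_Nil_words n \<subseteq> {w. set w \<subseteq> UNIV \<times> {..n} \<and> length w = n}"
    by (auto simp: tree_or_Nil_words_def closed_word_def in_set_conv_nth
        dest!: tree_or_NilD(2)) (metis less_imp_le_nat order_trans snd_conv)
  show "finite {w :: (bool \<times> nat) list. set w \<subseteq> UNIV \<times> {..n} \<and> length w = n}"
    by (rule finite_lists_length_eq) simp
qed

lemma tree_words_subset: "tree_words n \<subseteq> tree_or_Nil_words n"
  by (auto simp: tree_words_def tree_or_Nil_words_def tree_or_Nil_def)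

lemma finite_tree_words: "finite (tree_words n)"
  using finite_subset[OF tree_words_subset finite_tree_or_Nil_words] .

lemma tree_words_0: "tree_words 0 = {}"
  by (auto simp: tree_words_def tree_word_def)

lemma tree_or_Nil_words_0: "tree_or_Nil_words 0 = {[]}"
  by (auto simp: tree_or_Nil_words_def tree_or_Nil_def)

lemma tree_or_Nil_words_pos: "0 < n \<Longrightarrow> tree_or_Nil_words n = tree_words n"
  by (auto simp: tree_words_def tree_or_Nil_words_def tree_or_Nil_def)

text \<open>The coefficients of the equation for \<open>T\<close>. The first summand belongs to
  \<open>a = b = []\<close>; in the double sum, \<open>j\<close> is the length of \<open>a\<close>
  and \<open>i\<close> that of \<open>a @ b\<close>.\<close>

lemma card_tree_words_Suc:
  "card (tree_words (Suc n)) = card (tree_or_Nil_words n) +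
     (\<Sum>i\<le>n. (\<Sum>j\<le>i. card (tree_words j) * card (tree_or_Nil_words (i - j))) *
        card (tree_or_Nil_words (n - i)))"
proof -
  let ?T = tree_words and ?S = tree_or_Nil_words
  let ?I = "Sigma {..n} (\<lambda>i. {..i})"
  define F where "F = (\<lambda>(i, j). ?T j \<times> ?S (i - j) \<times> ?S (n - i))"
  define X where "X = {[] :: (bool \<times> nat) list} \<times> {[] :: (bool \<times> nat) list} \<times> ?S n"
  define Y where "Y = (\<Union>p\<in>?I. F p)"
  let ?f = "\<lambda>(a, b, c). graft a b c"
  have XY: "X \<union> Y = {(a, b, c). tree_or_Nil a \<and> tree_or_Nil b \<and> tree_or_Nil c \<and>
      (a = [] \<longrightarrow> b = []) \<and> length a + length b + length c = n}" (is "_ = ?R")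
  proof
    show "X \<union> Y \<subseteq> ?R"
      by (auto simp: X_def Y_def F_def tree_words_def tree_or_Nil_words_def tree_or_Nil_def tree_word_def)
    show "?R \<subseteq> X \<union> Y"
    proof clarify
      fix a b c
      assume *: "tree_or_Nil a" "tree_or_Nil b" "tree_or_Nil c" "a = [] \<longrightarrow> b = []"
        "n = length a + length b + length c" "(a, b, c) \<notin> Y"
      show "(a, b, c) \<in> X"
      proof (cases "a = []")
        case True
        then show ?thesis using * by (auto simp: X_def tree_or_Nil_words_def)
      next
        case False
        then have "(a, b, c) \<in> F (length a + length b, length a)"
          using * by (auto simp: F_def tree_words_def tree_or_Nil_words_def tree_or_Nil_def)
        then show ?thesis using * by (auto simp: Y_def)
      qed
    qed
  qed
  have "?T (Suc n) = ?f ` (X \<union> Y)"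
  proof
    show "?T (Suc n) \<subseteq> ?f ` (X \<union> Y)"
    proof
      fix w assume "w \<in> ?T (Suc n)"
      then have "tree_word w" and l: "length w = Suc n"
        by (auto simp: tree_words_def)
      then obtain a b c where abc: "tree_or_Nil a" "tree_or_Nil b" "tree_or_Nil c" "a = [] \<longrightarrow> b = []"
        "w = graft a b c"
        using tree_word_decompose by blast
      then have "(a, b, c) \<in> X \<union> Y"
        unfolding XY using l by simp
      then show "w \<in> ?f ` (X \<union> Y)"
        using abc(5) by force
    qed
    show "?f ` (X \<union> Y) \<subseteq> ?T (Suc n)"
      unfolding XY by (auto simp: tree_words_def intro: tree_word_graft)
  qed
  moreover have "inj_on ?f (X \<union> Y)"
    unfolding XY
  proof (rule inj_onI)
    fix p q assume *: "p \<in> ?R" "q \<in> ?R" "?f p = ?f q"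
    obtain a b c a' b' c' where "p = (a, b, c)" "q = (a', b', c')"
      by (cases p; cases q)
    then show "p = q"
      using * graft_inject[of a b c a' b' c'] by simp
  qed
  ultimately have "card (?T (Suc n)) = card (X \<union> Y)"
    by (simp add: card_image)
  also have "\<dots> = card X + card Y"
  proof (rule card_Un_disjoint)
    show "finite X" "finite Y"
      by (auto simp: X_def Y_def F_def finite_tree_words finite_tree_or_Nil_words)
    show "X \<inter> Y = {}"
      by (auto simp: X_def Y_def F_def tree_words_def tree_word_def)
  qed
  also have "card X = card (?S n)"
    by (simp add: X_def card_cartesian_product)
  also have "card Y = (\<Sum>p\<in>?I. card (F p))"
    unfolding Y_def
  proof (rule card_UN_disjoint)
    show "finite ?I" by simp
    show "\<forall>p\<in>?I. finite (F p)"
      by (auto simp: F_def finite_tree_words finite_tree_or_Nil_words)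
    show "\<forall>p\<in>?I. \<forall>q\<in>?I. p \<noteq> q \<longrightarrow> F p \<inter> F q = {}"
      by (auto simp: F_def tree_words_def tree_or_Nil_words_def)
  qed
  also have "\<dots> = (\<Sum>i\<le>n. \<Sum>j\<le>i. card (?T j) * card (?S (i - j)) * card (?S (n - i)))"
    by (subst sum.Sigma) (auto simp: F_def card_cartesian_product mult.assoc intro!: sum.cong)
  finally show ?thesis
    by (simp add: sum_distrib_right)
qed

section \<open>Encoding pairs of partitions by words\<close>

text \<open>Positions count from 0 but elements from 1, hence the shifts by one here and wherever
  functions are transferred.\<close>

definition encode :: "nat \<Rightarrow> nat set set \<Rightarrow> nat set set \<Rightarrow> (bool \<times> nat) list" where
  "encode n P R = map (\<lambda>k. (block_min P (Suc k) = Suc k, Suc k - block_min R (Suc k))) [0..<n]"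

lemma length_encode [simp]: "length (encode n P R) = n"
  by (simp add: encode_def)

lemma encode_nth:
  "k < n \<Longrightarrow> encode n P R ! k = (block_min P (Suc k) = Suc k, Suc k - block_min R (Suc k))"
  by (simp add: encode_def)

lemma ball_Suc_iff: "(\<forall>i\<in>{1..n}. Q i) \<longleftrightarrow> (\<forall>k<n. Q (Suc k))"
proof
  assume *: "\<forall>k<n. Q (Suc k)"
  show "\<forall>i\<in>{1..n}. Q i"
  proof
    fix i assume "i \<in> {1..n}"
    then show "Q i" using * by (cases i) auto
  qed
qed simp

context
  fixes n :: nat and P :: "nat set set"
  assumes P: "partition_on {1..n} P"
begin

lemma block_min_mem:
  assumes "V \<in> P" "x \<in> V"
  shows "block_min P x \<in> V" "block_min P x \<le> x"
proof -
  have "finite V"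
    using partition_on_block_subset[OF P assms(1)] finite_subset by blast
  moreover have "V \<noteq> {}" using assms(2) by auto
  ultimately show "block_min P x \<in> V" "block_min P x \<le> x"
    using assms block_min_eq[OF P assms] Min_in[of V] by auto
qed

lemma block_min_eq_iff:
  assumes "V \<in> P" "x \<in> V" "y \<in> {1..n}"
  shows "y \<in> V \<longleftrightarrow> block_min P y = block_min P x"
proof
  assume "y \<in> V"
  then show "block_min P y = block_min P x"
    using assms block_min_eq[OF P] by simp
next
  assume eq: "block_min P y = block_min P x"
  obtain W where W: "W \<in> P" "y \<in> W"
    using partition_on_obtain_block[OF P assms(3)] by blast
  then have "Min W = Min V"
    using eq assms block_min_eq[OF P] by simp
  then have "W = V"
    using inj_on_Min[OF P] W assms by (auto dest: inj_onD)
  then show "y \<in> V" using W by simp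
qed

lemma block_min_in_range:
  assumes "i \<in> {1..n}"
  shows "block_min P i \<in> {1..n}" "block_min P i \<le> i" "block_min P (block_min P i) = block_min P i"
proof -
  obtain V where V: "V \<in> P" "i \<in> V"
    using partition_on_obtain_block[OF P assms] by blast
  show "block_min P i \<in> {1..n}" "block_min P i \<le> i"
    using block_min_mem[OF V] partition_on_block_subset[OF P V(1)] by auto
  then show "block_min P (block_min P i) = block_min P i"
    using block_min_eq_iff[OF V] block_min_mem[OF V] by blast
qed

lemma constant_on_blocks_iff:
  "constant_on_blocks f P \<longleftrightarrow> (\<forall>i\<in>{1..n}. f i = f (block_min P i))"
proof
  assume f: "constant_on_blocks f P"
  show "\<forall>i\<in>{1..n}. f i = f (block_min P i)"
  proof
    fix i assume "i \<in> {1..n}"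
    then obtain V where V: "V \<in> P" "i \<in> V"
      using partition_on_obtain_block[OF P] by blast
    show "f i = f (block_min P i)"
      using constant_on_blocksD[OF f V block_min_mem(1)[OF V]] .
  qed
next
  assume f: "\<forall>i\<in>{1..n}. f i = f (block_min P i)"
  show "constant_on_blocks f P"
    unfolding constant_on_blocks_def
  proof (intro ballI)
    fix V x y assume V: "V \<in> P" "x \<in> V" "y \<in> V"
    have "x \<in> {1..n}" "y \<in> {1..n}"
      using V partition_on_block_subset[OF P] by blast+
    moreover have "block_min P x = block_min P y"
      using V block_min_eq[OF P] by simp
    ultimately show "f x = f y"
      using f by metis
  qed
qed

lemma constant_on_blocks_cong:
  assumes "\<And>i. i \<in> {1..n} \<Longrightarrow> f i = g i"
  shows "constant_on_blocks f P \<longleftrightarrow> constant_on_blocks g P"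
proof -
  have "f i = f (block_min P i) \<longleftrightarrow> g i = g (block_min P i)" if "i \<in> {1..n}" for i
    using assms[OF that] assms[OF block_min_in_range(1)[OF that]] by simp
  then show ?thesis
    unfolding constant_on_blocks_iff by blast
qed

lemma card_block_minima: "card {k. k < n \<and> block_min P (Suc k) = Suc k} = card P"
proof -
  have "Suc ` {k. k < n \<and> block_min P (Suc k) = Suc k} = block_min P ` {1..n}"
  proof
    show "Suc ` {k. k < n \<and> block_min P (Suc k) = Suc k} \<subseteq> block_min P ` {1..n}"
    proof
      fix i assume "i \<in> Suc ` {k. k < n \<and> block_min P (Suc k) = Suc k}"
      then have "block_min P i = i" "i \<in> {1..n}" by auto
      then show "i \<in> block_min P ` {1..n}" by (metis image_eqI)
    qed
    show "block_min P ` {1..n} \<subseteq> Suc ` {k. k < n \<and> block_min P (Suc k) = Suc k}"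
    proof
      fix m assume "m \<in> block_min P ` {1..n}"
      then obtain i where i: "i \<in> {1..n}" "m = block_min P i" by blast
      then have "m \<in> {1..n}" "block_min P m = m"
        using block_min_in_range[OF i(1)] by auto
      then show "m \<in> Suc ` {k. k < n \<and> block_min P (Suc k) = Suc k}"
        by (intro image_eqI[of _ _ "m - 1"]) auto
    qed
  qed
  then have "card {k. k < n \<and> block_min P (Suc k) = Suc k} = card (Min ` P)"
    using block_min_image[OF P] card_image[OF inj_Suc, of "{k. k < n \<and> block_min P (Suc k) = Suc k}"]
    by simp
  then show ?thesis
    using inj_on_Min[OF P] by (simp add: card_image)
qed

end

lemma partition_eqI_block_min:
  assumes P: "partition_on {1..n} P" and Q: "partition_on {1..n} Q"
    and eq: "\<And>i. i \<in> {1..n} \<Longrightarrow> block_min P i = block_min Q i"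
  shows "P = Q"
proof -
  have sub: "P' \<subseteq> Q'"
    if P': "partition_on {1..n} P'" and Q': "partition_on {1..n} Q'"
      and eq': "\<And>i. i \<in> {1..n} \<Longrightarrow> block_min P' i = block_min Q' i" for P' Q'
  proof
    fix V assume V: "V \<in> P'"
    then obtain x where x: "x \<in> V" "x \<in> {1..n}"
      using partition_on_block_nonempty[OF P'] partition_on_block_subset[OF P'] by blast
    then obtain W where W: "W \<in> Q'" "x \<in> W"
      using partition_on_obtain_block[OF Q'] by blast
    have "y \<in> V \<longleftrightarrow> y \<in> W" if "y \<in> {1..n}" for y
      using block_min_eq_iff[OF P' V x(1) that] block_min_eq_iff[OF Q' W that]
        eq'[OF that] eq'[OF x(2)] by simp
    then have "V = W"
      using partition_on_block_subset[OF P' V] partition_on_block_subset[OF Q' W(1)] by blast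
    then show "V \<in> Q'" using W by simp
  qed
  show ?thesis
    using sub[OF P Q eq] sub[OF Q P eq[symmetric]] by blast
qed

text \<open>By convexity, an element that is not the least of its block shares the block with its
  predecessor. This is why flags suffice to record an interval partition.\<close>

lemma block_min_Int_part:
  assumes P: "P \<in> Int_part n" and i: "i \<in> {1..n}" "block_min P i \<noteq> i"
  shows "i - 1 \<in> {1..n}" "block_min P (i - 1) = block_min P i"
proof -
  note pP = NC_D(1)[OF Int_part_D(1)[OF P]]
  obtain V where V: "V \<in> P" "i \<in> V"
    using partition_on_obtain_block[OF pP i(1)] by blast
  have "block_min P i < i" "block_min P i \<in> V"
    using block_min_mem[OF pP V] i by auto
  then have "i - 1 \<in> V"
    using Int_part_D(2)[OF P V(1) _ V(2), of "block_min P i" "i - 1"] by auto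
  then show "i - 1 \<in> {1..n}" "block_min P (i - 1) = block_min P i"
    using partition_on_block_subset[OF pP V(1)] block_min_eq[OF pP V(1)] V(2) by auto
qed

lemma constant_on_blocks_Int_part_iff:
  assumes P: "P \<in> Int_part n"
  shows "constant_on_blocks f P \<longleftrightarrow> (\<forall>i\<in>{1..n}. block_min P i \<noteq> i \<longrightarrow> f i = f (i - 1))"
proof
  note pP = NC_D(1)[OF Int_part_D(1)[OF P]]
  show "\<forall>i\<in>{1..n}. block_min P i \<noteq> i \<longrightarrow> f i = f (i - 1)" if "constant_on_blocks f P"
    using that block_min_Int_part[OF P] unfolding constant_on_blocks_iff[OF pP] by metis
  assume *: "\<forall>i\<in>{1..n}. block_min P i \<noteq> i \<longrightarrow> f i = f (i - 1)"
  have "f i = f (block_min P i)" if "i \<in> {1..n}" for i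
    using that
  proof (induction i)
    case (Suc i)
    then show ?case
      using *[rule_format, OF Suc.prems] block_min_Int_part[OF P Suc.prems]
      by (cases "block_min P (Suc i) = Suc i") auto
  qed simp
  then show "constant_on_blocks f P"
    unfolding constant_on_blocks_iff[OF pP] by blast
qed

lemma par_encode:
  assumes "R \<in> NC n" "k < n"
  shows "Suc (par (encode n P R) k) = block_min R (Suc k)"
  using block_min_in_range[OF NC_D(1)[OF assms(1)], of "Suc k"] assms(2)
  by (auto simp: par_def encode_nth)

lemma link_invariant_encode:
  assumes P: "P \<in> Int_part n" and R: "R \<in> NC n"
  shows "link_invariant (encode n P R) f \<longleftrightarrow>
    constant_on_blocks (\<lambda>i. f (i - 1)) P \<and> constant_on_blocks (\<lambda>i. f (i - 1)) R"
proof -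
  have "f (par (encode n P R) k) = f (block_min R (Suc k) - 1)" if "k < n" for k
    using par_encode[OF R that, of P] by (metis diff_Suc_1)
  then show ?thesis
    unfolding constant_on_blocks_Int_part_iff[OF P] constant_on_blocks_iff[OF NC_D(1)[OF R]]
      ball_Suc_iff link_invariant_def
    by (auto simp: encode_nth)
qed

lemma conn_word_encode:
  assumes P: "P \<in> Int_part n" and R: "R \<in> NC n" and n: "0 < n"
  shows "conn_word (encode n P R) \<longleftrightarrow> jointly_connected {1..n} P R"
proof
  assume conn: "conn_word (encode n P R)"
  show "jointly_connected {1..n} P R"
    unfolding jointly_connected_def
  proof (intro allI impI ballI)
    fix g :: "nat \<Rightarrow> bool" and x y
    assume g: "constant_on_blocks g P" "constant_on_blocks g R" and xy: "x \<in> {1..n}" "y \<in> {1..n}"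
    have "link_invariant (encode n P R) (\<lambda>k. g (Suc k))"
      unfolding link_invariant_encode[OF P R]
      using g constant_on_blocks_cong[OF NC_D(1)[OF Int_part_D(1)[OF P]], of "\<lambda>i. g (Suc (i - 1))" g]
        constant_on_blocks_cong[OF NC_D(1)[OF R], of "\<lambda>i. g (Suc (i - 1))" g] by simp
    from conn_word_const[OF conn this, of "x - 1" "y - 1"] show "g x = g y"
      using xy by auto
  qed
next
  assume conn: "jointly_connected {1..n} P R"
  show "conn_word (encode n P R)"
    unfolding conn_word_def
  proof (intro allI impI)
    fix f :: "nat \<Rightarrow> bool" and i
    assume "link_invariant (encode n P R) f" "i < length (encode n P R)"
    then show "f i = f 0"
      using jointly_connectedD[OF conn, of "\<lambda>i. f (i - 1)" "Suc i" "Suc 0"] n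
      unfolding link_invariant_encode[OF P R] by simp
  qed
qed

lemma num_blocks_encode:
  assumes P: "P \<in> NC n" and R: "R \<in> NC n"
  shows "num_blocks (encode n P R) = card P + card R"
proof -
  have "{k. k < n \<and> fst (encode n P R ! k)} = {k. k < n \<and> block_min P (Suc k) = Suc k}"
    by (auto simp: encode_nth)
  moreover have "{k. k < n \<and> snd (encode n P R ! k) = 0} = {k. k < n \<and> block_min R (Suc k) = Suc k}"
  proof -
    have "snd (encode n P R ! k) = 0 \<longleftrightarrow> block_min R (Suc k) = Suc k" if "k < n" for k
      using block_min_in_range(2)[OF NC_D(1)[OF R], of "Suc k"] that by (auto simp: encode_nth)
    then show ?thesis by blast
  qed
  ultimately show ?thesis
    using card_block_minima[OF NC_D(1)[OF P]] card_block_minima[OF NC_D(1)[OF R]]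
    by (simp add: num_blocks_def length_filter_conv_card)
qed

text \<open>If an arc under the arc of \<open>Suc j\<close> started further left, the ends of the
  two arcs would form a crossing.\<close>

lemma nc_word_encode:
  assumes R: "R \<in> NC n"
  shows "nc_word (encode n P R)"
  unfolding nc_word_def
proof (intro conjI allI impI)
  note pR = NC_D(1)[OF R]
  have "snd (encode n P R ! k) \<le> k" if "k < n" for k
    using block_min_in_range(1)[OF pR, of "Suc k"] that by (auto simp: encode_nth)
  then show "closed_word (encode n P R)"
    by (simp add: closed_word_def)
  fix i j
  assume "j < length (encode n P R)" "i \<le> j" "par (encode n P R) j \<le> i"
  then have ij: "j < n" "i < n" "i \<le> j" "block_min R (Suc j) \<le> Suc i"
    using par_encode[OF R, of j P] by auto
  have "block_min R (Suc j) \<le> block_min R (Suc i)"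
  proof (rule ccontr)
    assume lt: "\<not> block_min R (Suc j) \<le> block_min R (Suc i)"
    obtain U V where U: "U \<in> R" "Suc j \<in> U" and V: "V \<in> R" "Suc i \<in> V"
      using partition_on_obtain_block[OF pR, of "Suc i"] partition_on_obtain_block[OF pR, of "Suc j"]
        ij by auto
    have ne: "U \<noteq> V"
      using lt U V block_min_eq[OF pR] by auto
    then have "Suc i \<notin> U"
      using partition_on_unique_block[OF pR U(1) V(1) _ V(2)] by blast
    then have "Suc i \<noteq> block_min R (Suc j)" "i \<noteq> j"
      using block_min_mem(1)[OF pR U] U(2) by auto
    then show False
      using noncrossingD[OF NC_D(2)[OF R] U(1) V(1) block_min_mem(1)[OF pR U] U(2) V(2)
          block_min_mem(1)[OF pR V]] ij lt ne by auto
  qed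
  then show "par (encode n P R) j \<le> par (encode n P R) i"
    using par_encode[OF R, of _ P] ij by (metis Suc_le_mono)
qed

lemma tree_word_encode:
  assumes P: "P \<in> Int_part n" and R: "R \<in> NC n" and n: "0 < n"
  shows "tree_word (encode n P R) \<longleftrightarrow> jointly_connected {1..n} P R \<and> card P + card R = n + 1"
proof -
  have "fst (encode n P R ! 0)"
    using block_min_in_range(1,2)[OF NC_D(1)[OF Int_part_D(1)[OF P]], of "Suc 0"] n
    by (auto simp: encode_nth)
  moreover have "encode n P R \<noteq> []"
    using n by (simp add: encode_def)
  ultimately show ?thesis
    using conn_word_encode[OF P R n] nc_word_encode[OF R] num_blocks_encode[OF Int_part_D(1)[OF P] R]
    by (simp add: tree_word_def)
qed

text \<open>Offsets give the least elements for \<open>R\<close> at once; for \<open>P\<close> they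
  follow by induction, an unflagged element inheriting that of its predecessor.\<close>

lemma encode_inject:
  assumes P: "P \<in> Int_part n" "P' \<in> Int_part n" and R: "R \<in> NC n" "R' \<in> NC n"
    and eq: "encode n P R = encode n P' R'"
  shows "P = P' \<and> R = R'"
proof
  have bits: "block_min P (Suc k) = Suc k \<longleftrightarrow> block_min P' (Suc k) = Suc k"
    and offs: "Suc k - block_min R (Suc k) = Suc k - block_min R' (Suc k)" if "k < n" for k
    using arg_cong[OF eq, of "\<lambda>w. w ! k"] that by (simp_all add: encode_nth)
  show "P = P'"
  proof (rule partition_eqI_block_min)
    show "partition_on {1..n} P" "partition_on {1..n} P'"
      using P Int_part_D(1) NC_D(1) by blast+
    show "block_min P i = block_min P' i" if "i \<in> {1..n}" for i
      using that
    proof (induction i)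
      case (Suc i)
      then show ?case
        using bits[of i] block_min_Int_part[OF P(1) Suc.prems] block_min_Int_part[OF P(2) Suc.prems]
        by (cases "block_min P (Suc i) = Suc i") auto
    qed simp
  qed
  show "R = R'"
  proof (rule partition_eqI_block_min)
    show pR: "partition_on {1..n} R" "partition_on {1..n} R'"
      using R NC_D(1) by blast+
    show "block_min R i = block_min R' i" if i: "i \<in> {1..n}" for i
    proof -
      obtain k where k: "i = Suc k" "k < n"
        using i by (cases i) auto
      then show ?thesis
        using offs[OF k(2)] block_min_in_range(2)[OF pR(1) i]
          block_min_in_range(2)[OF pR(2) i] by simp
    qed
  qed
qed

section \<open>Decoding words into partitions\<close>

definition level_sets :: "'a set \<Rightarrow> ('a \<Rightarrow> 'b) \<Rightarrow> 'a set set" where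
  "level_sets A f = (\<lambda>v. {i \<in> A. f i = v}) ` f ` A"

lemma partition_on_level_sets: "partition_on A (level_sets A f)"
  by (rule partition_onI) (auto simp: level_sets_def disjnt_def)

lemma block_min_level_sets:
  assumes "\<And>i. i \<in> {1..n} \<Longrightarrow> f i \<in> {1..n} \<and> f i \<le> i \<and> f (f i) = f i" "i \<in> {1..n}"
  shows "block_min (level_sets {1..n} f) i = f i"
proof -
  have "block_min (level_sets {1..n} f) i = Min {j \<in> {1..n}. f j = f i}"
    using assms(2) by (intro block_min_eq[OF partition_on_level_sets]) (auto simp: level_sets_def)
  also have "\<dots> = f i"
  proof (rule Min_eqI)
    show "f i \<le> j" if "j \<in> {j \<in> {1..n}. f j = f i}" for j
      using assms(1)[of j] that by auto
    show "f i \<in> {j \<in> {1..n}. f j = f i}"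
      using assms by blast
  qed simp
  finally show ?thesis .
qed

lemma encode_surj:
  assumes w: "tree_word w"
  shows "\<exists>P\<in>Int_part (length w). \<exists>R\<in>NC (length w). encode (length w) P R = w"
proof -
  define n where "n = length w"
  have head: "fst (w ! 0)" and nc: "nc_word w"
    using w by (auto simp: tree_word_def)
  \<comment> \<open>\<open>\<nu> i\<close> is the last flagged element up to \<open>i\<close>, that
    is, the start of its interval. Since the first letter is flagged, the initial value 0 does not
    occur for \<open>i > 0\<close>.\<close>
  define \<nu> where "\<nu> = rec_nat 0 (\<lambda>i m. if fst (w ! i) then Suc i else m)"
  have \<nu>_Suc: "\<nu> (Suc i) = (if fst (w ! i) then Suc i else \<nu> i)" and \<nu>_0: "\<nu> 0 = 0" for i
    by (simp_all add: \<nu>_def)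
  have \<nu>_pos: "1 \<le> \<nu> (Suc i)" for i
    using head by (induction i) (auto simp: \<nu>_Suc)
  have \<nu>_le: "\<nu> i \<le> i" for i
    by (induction i) (auto simp: \<nu>_Suc \<nu>_0)
  have \<nu>_const: "\<nu> i = \<nu> j" if "\<nu> j \<le> i" "i \<le> j" for i j
    using that
  proof (induction j)
    case (Suc j)
    then show ?case
      by (cases "i = Suc j") (auto simp: \<nu>_Suc split: if_splits)
  qed simp
  have \<nu>: "\<nu> i \<in> {1..n} \<and> \<nu> i \<le> i \<and> \<nu> (\<nu> i) = \<nu> i" if "i \<in> {1..n}" for i
    using \<nu>_pos[of "i - 1"] \<nu>_le[of i] \<nu>_const[of i "\<nu> i"] that by auto
  define \<mu> where "\<mu> i = Suc (par w (i - 1))" for i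
  have \<mu>_nc: "\<mu> j \<le> \<mu> i" if "\<mu> j \<le> i" "i \<le> j" "j \<in> {1..n}" for i j
    using nc_wordD[OF nc, of "j - 1" "i - 1"] that by (auto simp: \<mu>_def n_def)
  have \<mu>_le: "\<mu> i \<le> i" if "i \<in> {1..n}" for i
    using par_le[of w "i - 1"] that by (auto simp: \<mu>_def)
  have \<mu>: "\<mu> i \<in> {1..n} \<and> \<mu> i \<le> i \<and> \<mu> (\<mu> i) = \<mu> i" if i: "i \<in> {1..n}" for i
  proof -
    have "\<mu> i \<le> i" using \<mu>_le[OF i] .
    moreover have "1 \<le> \<mu> i" by (simp add: \<mu>_def)
    ultimately have "\<mu> i \<in> {1..n}" using i by auto
    \<comment> \<open>Nesting applied to the start of an arc gives idempotence.\<close>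
    moreover have "\<mu> i \<le> \<mu> (\<mu> i)"
      using \<mu>_nc[of i "\<mu> i"] \<open>\<mu> i \<le> i\<close> i by simp
    ultimately show ?thesis
      using \<mu>_le[of "\<mu> i"] \<open>\<mu> i \<le> i\<close> by auto
  qed
  define P R where "P = level_sets {1..n} \<nu>" and "R = level_sets {1..n} \<mu>"
  have convex: "y \<in> V"
    if V: "V \<in> P" and xyz: "x \<in> V" "z \<in> V" "x \<le> y" "y \<le> z" for V x y z
  proof -
    obtain v where v: "V = {i \<in> {1..n}. \<nu> i = v}"
      using V by (auto simp: P_def level_sets_def)
    have "\<nu> z \<le> x"
      using xyz v \<nu>_le[of x] by simp
    then show ?thesis
      using xyz v \<nu>_const[of z y] by auto
  qed
  have P_NC: "P \<in> NC n"
    unfolding NC_def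
  proof (intro CollectI conjI)
    show "partition_on {1..n} P"
      unfolding P_def by (rule partition_on_level_sets)
    then show "noncrossing P"
      unfolding noncrossing_iff
    proof (intro ballI impI)
      fix U V b d x y
      assume "partition_on {1..n} P" and UV: "U \<in> P" "V \<in> P" "b \<in> U" "d \<in> U" "x \<in> V"
        and "b < x" "x < d"
      then show "U = V"
        using convex[OF UV(1,3,4), of x] partition_on_unique_block[of _ P U V x] by simp
    qed
  qed
  have "P \<in> Int_part n"
    unfolding Int_part_def
  proof (intro CollectI conjI ballI P_NC)
    fix V assume V: "V \<in> P"
    have sub: "V \<subseteq> {1..n}" and ne: "V \<noteq> {}"
      using partition_on_block_subset[OF NC_D(1)[OF P_NC] V]
        partition_on_block_nonempty[OF NC_D(1)[OF P_NC] V] by auto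
    then have fin: "finite V" using finite_subset by blast
    have "V = {Min V..Max V}"
    proof (intro equalityI subsetI)
      fix y assume "y \<in> V"
      then show "y \<in> {Min V..Max V}" using fin by simp
    next
      fix y assume "y \<in> {Min V..Max V}"
      then show "y \<in> V"
        using convex[OF V Min_in[OF fin ne] Max_in[OF fin ne], of y] by simp
    qed
    moreover have "Min V \<in> {1..n}" "Max V \<in> {1..n}" "Min V \<le> Max V"
      using subsetD[OF sub Min_in[OF fin ne]] subsetD[OF sub Max_in[OF fin ne]]
        Min_le[OF fin Max_in[OF fin ne]] by simp_all
    ultimately show "\<exists>p\<in>{1..n}. \<exists>q\<in>{1..n}. p \<le> q \<and> V = {p..q}"
      by (intro bexI[of _ "Min V"] bexI[of _ "Max V"] conjI)
  qed
  moreover have "R \<in> NC n"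
    unfolding NC_def
  proof (intro CollectI conjI)
    show "partition_on {1..n} R"
      unfolding R_def by (rule partition_on_level_sets)
    show "noncrossing R"
      unfolding noncrossing_iff
    proof (intro ballI impI)
      fix U V b d x y
      assume "U \<in> R" "V \<in> R" "b \<in> U" "d \<in> U" "x \<in> V" "y \<in> V"
        and lt: "b < x" "x < d" "y < b \<or> d < y"
      then obtain p q where U: "U = {i \<in> {1..n}. \<mu> i = p}" and V: "V = {i \<in> {1..n}. \<mu> i = q}"
        by (auto simp: R_def level_sets_def)
      have mem: "\<mu> b = p" "\<mu> d = p" "\<mu> x = q" "\<mu> y = q"
        "b \<in> {1..n}" "d \<in> {1..n}" "x \<in> {1..n}" "y \<in> {1..n}"
        using U V \<open>b \<in> U\<close> \<open>d \<in> U\<close> \<open>x \<in> V\<close> \<open>y \<in> V\<close> by auto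
      \<comment> \<open>The starts are compared by nesting: once under the arc of \<open>d\<close>,
        once under the arc of the larger of \<open>x\<close> and \<open>y\<close>.\<close>
      have "p \<le> q"
        using \<mu>_nc[of d x] \<mu>_le[of b] mem lt by simp
      moreover have "q \<le> p"
        using lt(3)
      proof
        assume "y < b"
        then show ?thesis using \<mu>_nc[of x b] \<mu>_le[of y] mem lt by simp
      next
        assume "d < y"
        then show ?thesis using \<mu>_nc[of y d] \<mu>_le[of x] mem lt by simp
      qed
      ultimately show "U = V"
        using U V by simp
    qed
  qed
  moreover have "encode n P R = w"
  proof (rule nth_equalityI)
    show "length (encode n P R) = length w"
      by (simp add: n_def)
    fix k assume "k < length (encode n P R)"
    then have k: "k < n" "Suc k \<in> {1..n}" by simp_all
    have "block_min P (Suc k) = \<nu> (Suc k)" "block_min R (Suc k) = \<mu> (Suc k)"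
      unfolding P_def R_def using block_min_level_sets \<nu> \<mu> k(2) by blast+
    moreover have "\<nu> (Suc k) = Suc k \<longleftrightarrow> fst (w ! k)"
      using \<nu>_le[of k] by (auto simp: \<nu>_Suc)
    moreover have "Suc k - \<mu> (Suc k) = snd (w ! k)"
      using nc k by (simp add: \<mu>_def par_def nc_word_def closed_word_def n_def)
    ultimately show "encode n P R ! k = w ! k"
      using k by (simp add: encode_nth prod_eq_iff)
  qed
  ultimately show ?thesis
    by (auto simp: n_def)
qed

lemma card_shallow_top_meanders:
  assumes n: "0 < n"
  shows "card (shallow_top_meanders n) = card (tree_words n)"
proof (rule bij_betw_same_card)
  have mem: "(P, R) \<in> shallow_top_meanders n \<longleftrightarrow>
      P \<in> Int_part n \<and> R \<in> NC n \<and> tree_word (encode n P R)" for P R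
    using dist_H_eq_iff[OF n] tree_word_encode[OF _ _ n] by (auto simp: shallow_top_meanders_def)
  show "bij_betw (\<lambda>(P, R). encode n P R) (shallow_top_meanders n) (tree_words n)"
    unfolding bij_betw_def
  proof
    show "inj_on (\<lambda>(P, R). encode n P R) (shallow_top_meanders n)"
    proof (rule inj_onI)
      fix p q
      assume *: "p \<in> shallow_top_meanders n" "q \<in> shallow_top_meanders n"
        "(\<lambda>(P, R). encode n P R) p = (\<lambda>(P, R). encode n P R) q"
      obtain P R P' R' where "p = (P, R)" "q = (P', R')"
        by (cases p; cases q)
      then show "p = q"
        using * encode_inject[of P n P' R R'] by (simp add: mem)
    qed
    show "(\<lambda>(P, R). encode n P R) ` shallow_top_meanders n = tree_words n"
    proof
      show "(\<lambda>(P, R). encode n P R) ` shallow_top_meanders n \<subseteq> tree_words n"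
        by (auto simp: mem tree_words_def)
      show "tree_words n \<subseteq> (\<lambda>(P, R). encode n P R) ` shallow_top_meanders n"
      proof
        fix w assume "w \<in> tree_words n"
        then have w: "tree_word w" "length w = n"
          by (auto simp: tree_words_def)
        then obtain P R where "P \<in> Int_part n" "R \<in> NC n" "encode n P R = w"
          using encode_surj[OF w(1)] by blast
        then show "w \<in> (\<lambda>(P, R). encode n P R) ` shallow_top_meanders n"
          using w(1) by (intro image_eqI[of _ _ "(P, R)"]) (auto simp: mem)
      qed
    qed
  qed
qed

section \<open>Growth rate of the cubic recursion\<close>

text \<open>The minimiser of the quotient solves \<open>2 * x^3 + 2 * x^2 = 1\<close> and is close
  to 0.565. The two nonnegative terms are the excesses of \<open>x^3\<close> and \<open>x^2\<close>
  over their tangents at 0.565; the first plus twice the second bounds the cubic below by a line of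
  slope 5.217... with positive constant term.\<close>

lemma cubic_lower_bound:
  fixes x :: real
  assumes "0 < x"
  shows "5.216 * x < (1 + x) + (1 + x)^2 * x"
proof -
  have "0 \<le> (x + 2 * 0.565) * (x - 0.565)^2"
    using assms by simp
  moreover have "0 \<le> (x - 0.565)^2" by simp
  ultimately show ?thesis
    using assms by (simp add: power2_eq_square field_simps)
qed

section \<open>Bounds for the coefficients of \<open>T\<close> and \<open>1 + T\<close>\<close>

locale cubic_recursion =
  fixes t s :: "nat \<Rightarrow> real"
  assumes t_nonneg: "\<And>n. 0 \<le> t n"
    and t0: "t 0 = 0"
    and s0: "s 0 = 1"
    and s_eq: "\<And>n. 0 < n \<Longrightarrow> s n = t n"
    and rec: "\<And>n. t (Suc n) = s n + (\<Sum>i\<le>n. (\<Sum>j\<le>i. t j * s (i - j)) * s (n - i))"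
begin

lemma s_nonneg: "0 \<le> s n"
  using t_nonneg[of n] s0 s_eq[of n] by (cases n) auto

lemma s_conv: "s n = (if n = 0 then 1 else 0) + t n"
  using s0 s_eq t0 by auto

text \<open>The triangle of index pairs with sum at most \<open>N\<close> lies in a square, whose
  other terms are nonnegative.\<close>

lemma sum_convolution_le:
  fixes a b :: "nat \<Rightarrow> real"
  assumes "\<And>n. 0 \<le> a n" "\<And>n. 0 \<le> b n"
  shows "(\<Sum>n\<le>N. \<Sum>i\<le>n. a i * b (n - i)) \<le> (\<Sum>n\<le>N. a n) * (\<Sum>n\<le>N. b n)"
proof -
  have "(\<Sum>n\<le>N. \<Sum>i\<le>n. a i * b (n - i)) = (\<Sum>(n, i)\<in>Sigma {..N} (\<lambda>n. {..n}). a i * b (n - i))"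
    by (simp add: sum.Sigma)
  also have "\<dots> = (\<Sum>(i, j)\<in>(\<lambda>(n, i). (i, n - i)) ` Sigma {..N} (\<lambda>n. {..n}). a i * b j)"
    by (subst sum.reindex) (auto simp: inj_on_def case_prod_beta)
  also have "\<dots> \<le> (\<Sum>(i, j)\<in>{..N} \<times> {..N}. a i * b j)"
    by (intro sum_mono2) (auto intro!: mult_nonneg_nonneg assms)
  also have "\<dots> = (\<Sum>n\<le>N. a n) * (\<Sum>n\<le>N. b n)"
    by (simp add: sum_product sum.cartesian_product)
  finally show ?thesis .
qed

lemma weighted_product:
  fixes x y z :: real
  assumes "i \<le> n"
  shows "(x * z ^ i) * (y * z ^ (n - i)) = x * y * z ^ n"
proof -
  have "(x * z ^ i) * (y * z ^ (n - i)) = x * y * (z ^ i * z ^ (n - i))"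
    by (simp add: mult_ac)
  also have "z ^ i * z ^ (n - i) = z ^ n"
    using assms by (simp flip: power_add)
  finally show ?thesis .
qed

lemma weighted_rec:
  fixes z :: real
  defines "a \<equiv> \<lambda>n. t n * z ^ n" and "b \<equiv> \<lambda>n. s n * z ^ n"
  shows "a (Suc n) = z * (b n + (\<Sum>i\<le>n. (\<Sum>j\<le>i. a j * b (i - j)) * b (n - i)))"
proof -
  have "(\<Sum>j\<le>i. a j * b (i - j)) = (\<Sum>j\<le>i. t j * s (i - j)) * z ^ i" for i
    unfolding sum_distrib_right a_def b_def
    by (intro sum.cong refl) (simp add: weighted_product)
  then have "(\<Sum>i\<le>n. (\<Sum>j\<le>i. a j * b (i - j)) * b (n - i)) =
      (\<Sum>i\<le>n. (\<Sum>j\<le>i. t j * s (i - j)) * s (n - i)) * z ^ n"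
    unfolding sum_distrib_right[of _ _ "z ^ n"]
    by (intro sum.cong refl) (simp add: b_def weighted_product)
  then show ?thesis
    by (simp add: a_def b_def rec algebra_simps)
qed

text \<open>\<open>x\<close> is a supersolution of the equation for \<open>T\<close>. Each partial
  sum is at most the right-hand side at the previous one, and the right-hand side is monotone, so no
  partial sum passes \<open>x\<close>.\<close>

lemma partial_sum_bound:
  assumes z: "0 \<le> z" and x: "0 \<le> x" "z * ((1 + x) + (1 + x)^2 * x) \<le> x"
  shows "(\<Sum>n\<le>N. t n * z ^ n) \<le> x"
proof (induction N)
  case 0
  then show ?case using x by (simp add: t0)
next
  case (Suc N)
  define a b where "a = (\<lambda>n. t n * z ^ n)" and "b = (\<lambda>n. s n * z ^ n)"
  have rec': "a (Suc n) = z * (b n + (\<Sum>i\<le>n. (\<Sum>j\<le>i. a j * b (i - j)) * b (n - i)))" for n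
    unfolding a_def b_def by (rule weighted_rec)
  define A where "A = (\<Sum>n\<le>N. a n)"
  have nn: "0 \<le> a n" "0 \<le> b n" for n
    using z t_nonneg s_nonneg by (auto simp: a_def b_def)
  have B: "(\<Sum>n\<le>N. b n) = 1 + A"
    unfolding A_def a_def b_def s_conv
    by (simp add: distrib_right sum.distrib if_distrib[of "\<lambda>y. y * _"] cong: if_cong)
  have A: "0 \<le> A" "A \<le> x"
    using Suc nn by (auto simp: A_def a_def intro: sum_nonneg)
  have "(\<Sum>n\<le>N. \<Sum>i\<le>n. (\<Sum>j\<le>i. a j * b (i - j)) * b (n - i)) \<le>
      (\<Sum>n\<le>N. \<Sum>j\<le>n. a j * b (n - j)) * (\<Sum>n\<le>N. b n)"
    by (rule sum_convolution_le) (auto intro!: sum_nonneg mult_nonneg_nonneg nn)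
  also have "\<dots> \<le> ((\<Sum>n\<le>N. a n) * (\<Sum>n\<le>N. b n)) * (\<Sum>n\<le>N. b n)"
    by (intro mult_right_mono sum_convolution_le sum_nonneg nn)
  also have "\<dots> = (1 + A)^2 * A"
    unfolding B by (simp add: A_def power2_eq_square)
  finally have conv: "(\<Sum>n\<le>N. \<Sum>i\<le>n. (\<Sum>j\<le>i. a j * b (i - j)) * b (n - i)) \<le> (1 + A)^2 * A" .
  have "(\<Sum>n\<le>Suc N. a n) = (\<Sum>n\<le>N. a (Suc n))"
    by (subst sum.atMost_Suc_shift) (simp add: a_def t0)
  also have "\<dots> = z * ((\<Sum>n\<le>N. b n) + (\<Sum>n\<le>N. \<Sum>i\<le>n. (\<Sum>j\<le>i. a j * b (i - j)) * b (n - i)))"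
    unfolding rec' by (simp only: sum_distrib_left[symmetric] sum.distrib)
  also have "\<dots> \<le> z * ((1 + A) + (1 + A)^2 * A)"
    using conv z B by (intro mult_left_mono) auto
  also have "\<dots> \<le> z * ((1 + x) + (1 + x)^2 * x)"
    using A z by (intro mult_left_mono add_mono mult_mono power_mono) auto
  finally show ?case
    using x by (simp add: a_def)
qed

lemma upper_bound: "t n \<le> 5.22 ^ n"
proof -
  have "t n * (1 / 5.22) ^ n \<le> (\<Sum>k\<le>n. t k * (1 / 5.22) ^ k)"
    by (rule member_le_sum) (auto simp: t_nonneg)
  \<comment> \<open>At 0.565 the quotient is 5.2191..., just below 5.22.\<close>
  also have "\<dots> \<le> 0.565"
    by (rule partial_sum_bound) (simp_all add: power2_eq_square)
  finally have "t n * (1 / 5.22) ^ n \<le> 1" by simp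
  then show ?thesis
    by (simp add: power_one_over field_simps)
qed

text \<open>The terms are nonnegative, so Cauchy products apply and a finite sum would solve the
  equation exactly. With \<open>z = 1 / 5.216\<close> the right-hand side exceeds every positive
  argument, and 0 is no solution either.\<close>

lemma not_summable: "\<not> summable (\<lambda>n. t n * (1 / 5.216) ^ n)"
proof
  define z :: real where "z = 1 / 5.216"
  define a b where "a = (\<lambda>n. t n * z ^ n)" and "b = (\<lambda>n. s n * z ^ n)"
  assume "summable (\<lambda>n. t n * (1 / 5.216) ^ n)"
  then have sa: "summable a" by (simp add: a_def z_def)
  have nn: "0 \<le> a n" "0 \<le> b n" for n
    using t_nonneg s_nonneg by (auto simp: a_def b_def z_def)
  have b_conv: "b = (\<lambda>n. (if n = 0 then 1 else 0) + a n)"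
    by (auto simp: b_def a_def s_conv distrib_right)
  have "(\<lambda>n. if n = 0 then 1 else 0 :: real) sums 1"
    using sums_single[of 0 "\<lambda>_. 1 :: real"] by simp
  then have "b sums (1 + suminf a)"
    unfolding b_conv using sa by (intro sums_add summable_sums)
  then have sb: "summable b" and B: "suminf b = 1 + suminf a"
    by (auto simp: sums_iff)
  define c where "c n = (\<Sum>j\<le>n. a j * b (n - j))" for n
  define d where "d n = (\<Sum>i\<le>n. c i * b (n - i))" for n
  have norm: "summable (\<lambda>n. norm (a n))" "summable (\<lambda>n. norm (b n))"
    using sa sb nn by auto
  have cn: "0 \<le> c n" for n
    unfolding c_def by (auto intro!: sum_nonneg mult_nonneg_nonneg nn)
  have c: "c sums (suminf a * suminf b)"
    unfolding c_def using Cauchy_product_sums[OF norm] .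
  then have "summable (\<lambda>n. norm (c n))"
    using cn by (auto simp: sums_iff)
  then have d: "d sums (suminf c * suminf b)"
    unfolding d_def using Cauchy_product_sums[OF _ norm(2)] by blast
  have "(\<lambda>n. z * (b n + d n)) sums (z * (suminf b + suminf c * suminf b))"
    using sb d by (intro sums_mult sums_add summable_sums)
  moreover have "z * (b n + d n) = a (Suc n)" for n
    unfolding d_def c_def unfolding a_def b_def by (rule weighted_rec[symmetric])
  ultimately have "(\<lambda>n. a (Suc n)) sums (z * (suminf b + suminf c * suminf b))"
    by simp
  then have "suminf a = z * (suminf b + suminf c * suminf b) + a 0"
    using sums_Suc[of a] by (simp add: sums_iff)
  also have "suminf c = suminf a * suminf b"
    using c by (simp add: sums_iff)
  finally have eq: "suminf a = z * ((1 + suminf a) + (1 + suminf a)^2 * suminf a)"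
    by (simp add: B a_def t0 power2_eq_square mult_ac)
  have "0 \<le> suminf a"
    using sa nn by (simp add: suminf_nonneg)
  then have pos: "0 < suminf a"
    using eq by (cases "suminf a = 0") (auto simp: z_def)
  show False
    using cubic_lower_bound[OF pos] eq by (simp add: z_def)
qed

lemma growth_rate:
  "\<bar>limsup (\<lambda>n. ereal (root n (t n))) - ereal 5.22\<bar> < ereal 0.005"
proof -
  define L where "L = limsup (\<lambda>n. ereal (root n (t n)))"
  have "\<forall>\<^sub>F n in sequentially. ereal (root n (t n)) \<le> ereal 5.22"
    using eventually_gt_at_top[of 0]
  proof eventually_elim
    case (elim n)
    have "root n (t n) \<le> root n (5.22 ^ n)"
      using elim upper_bound by (intro real_root_le_mono) auto
    then show ?case
      using elim by (simp add: real_root_power_cancel)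
  qed
  then have upper: "L \<le> ereal 5.22"
    unfolding L_def by (rule Limsup_bounded)
  \<comment> \<open>5.2155 exceeds 5.215, as the strict tolerance requires, and stays below 5.216,
    which makes the ratio of the geometric majorant less than 1.\<close>
  have lower: "ereal 5.2155 \<le> L"
  proof (rule ccontr)
    assume "\<not> ereal 5.2155 \<le> L"
    then have "L < ereal 5.2155" by simp
    then have "\<forall>\<^sub>F n in sequentially. ereal (root n (t n)) < ereal 5.2155"
      unfolding L_def by (rule Limsup_lessD)
    then have "\<forall>\<^sub>F n in sequentially. norm (t n * (1 / 5.216) ^ n) \<le> (5.2155 / 5.216) ^ n"
      using eventually_gt_at_top[of 0]
    proof eventually_elim
      case (elim n)
      have "t n = root n (t n) ^ n"
        using elim t_nonneg by simp
      also have "\<dots> \<le> 5.2155 ^ n"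
        using elim t_nonneg by (intro power_mono) auto
      finally have "t n * (1 / 5.216) ^ n \<le> 5.2155 ^ n * (1 / 5.216) ^ n"
        by (rule mult_right_mono) simp
      also have "\<dots> = (5.2155 / 5.216) ^ n"
        by (subst power_mult_distrib[symmetric]) simp
      finally show ?case
        using t_nonneg[of n] by simp
    qed
    then have "summable (\<lambda>n. t n * (1 / 5.216) ^ n)"
      by (rule summable_comparison_test_ev) (simp add: summable_geometric)
    then show False
      using not_summable by contradiction
  qed
  obtain l where "L = ereal l"
    using upper lower by (cases L) auto
  then show ?thesis
    using upper lower unfolding L_def[symmetric] by simp
qed

end

interpretation tree_words: cubic_recursion
  "\<lambda>n. real (card (tree_words n))" "\<lambda>n. real (card (tree_or_Nil_words n))"
proof
  show "real (card (tree_words (Suc n))) = real (card (tree_or_Nil_words n)) +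
      (\<Sum>i\<le>n. (\<Sum>j\<le>i. real (card (tree_words j)) * real (card (tree_or_Nil_words (i - j)))) *
         real (card (tree_or_Nil_words (n - i))))" for n
    unfolding card_tree_words_Suc by simp
qed (simp_all add: tree_words_0 tree_or_Nil_words_0 tree_or_Nil_words_pos)

theorem corollary5p5:
  shows "\<bar>shallow_top_growth_rate - ereal 5.22\<bar> < ereal 0.005"
proof -
  have "shallow_top_growth_rate = limsup (\<lambda>n. ereal (root n (real (card (tree_words n)))))"
    unfolding shallow_top_growth_rate_def
    by (rule Limsup_eq, rule eventually_mono[OF eventually_gt_at_top[of 0]])
      (simp add: card_shallow_top_meanders)
  then show ?thesis
    using tree_words.growth_rate by simp
qed

end
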